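(* Let $0<a<b<\infty$, $\Delta=[a,b]$, $\Psi\in C^{1}(\Delta,\mathbb{R})$ increasing with $\Psi'\neq0$ on $\Delta$, $0<\mu<1$, $0\le\nu\le1$, $\rho=\mu+\nu-\mu\nu$. Let $f:(a,b]\times\mathbb{R}\to\mathbb{R}$ be such that $f(\cdot,y(\cdot))\in\mathbf{C}_{1-\rho;\Psi}(\Delta,\mathbb{R})$ for every $y\in\mathbf{C}_{1-\rho;\Psi}(\Delta,\mathbb{R})$ and $|f(t,y_1)-f(t,y_2)|\le L|y_1-y_2|$ for all $t\in(a,b]$, $y_1,y_2\in\mathbb{R}$, where $L>0$ is a constant. Then for every $\epsilon>0$, if $y^*\in\mathbf{C}_{1-\rho;\Psi}(\Delta,\mathbb{R})$ satisfies $$\left|^H\mathbf{D}^{\mu,\nu;\Psi}_{a^+}y^*(t)-f(t,y^*(t))\right|\le\epsilon,\quad t\in\Delta,$$ then there exists a solution $y\in\mathbf{C}_{1-\rho;\Psi}(\Delta,\mathbb{R})$ of $^H\mathbf{D}^{\mu,\nu;\Psi}_{a^+}y(t)=f(t,y(t))$ with $\mathbf{I}^{1-\rho;\Psi}_{a^+}y^*(a)=\mathbf{I}^{1-\rho;\Psi}_{a^+}y(a)$ such that $$\|y^*-y\|_{\mathbf{C}_{1-\rho;\Psi}}\le\left(\frac{E_\mu\big(L(\Psi(b)-\Psi(a))^\mu\big)-1}{L}(\Psi(b)-\Psi(a))^{1-\rho}\right)\epsilon.$$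
   Context: $\mathbf{C}_{1-\rho;\Psi}(\Delta,\mathbb{R})=\{h:(a,b]\to\mathbb{R}: (\Psi(t)-\Psi(a))^{1-\rho}h(t)\in C(\Delta,\mathbb{R})\}$ with norm $\|h\|_{\mathbf{C}_{1-\rho;\Psi}}=\max_{t\in\Delta}|(\Psi(t)-\Psi(a))^{1-\rho}h(t)|$. $\mathbf{I}^{\alpha;\Psi}_{a^+}h(t)=\frac{1}{\Gamma(\alpha)}\int_a^t\Psi'(\eta)(\Psi(t)-\Psi(\eta))^{\alpha-1}h(\eta)\,d\eta$ for $\alpha>0$. $^H\mathbf{D}^{\mu,\nu;\Psi}_{a^+}h=\mathbf{I}^{\nu(1-\mu);\Psi}_{a^+}\left(\frac{1}{\Psi'(t)}\frac{d}{dt}\right)\mathbf{I}^{(1-\nu)(1-\mu);\Psi}_{a^+}h$ ($\Psi$-Hilfer derivative). A solution $y$ of the equation with $\mathbf{I}^{1-\rho;\Psi}_{a^+}y(a)=c$ is a $y\in\mathbf{C}_{1-\rho;\Psi}(\Delta,\mathbb{R})$ satisfying $y(t)=\frac{(\Psi(t)-\Psi(a))^{\rho-1}}{\Gamma(\rho)}c+\mathbf{I}^{\mu;\Psi}_{a^+}f(\cdot,y(\cdot))(t)$ on $(a,b]$. $E_\mu(z)=\sum_{k=0}^\infty\frac{z^k}{\Gamma(k\mu+1)}$ is the one-parameter Mittag-Leffler function. *)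

theory Defs
  imports "HOL-Analysis.Analysis"
begin

definition wC :: "(real \<Rightarrow> real) \<Rightarrow> real \<Rightarrow> real \<Rightarrow> real \<Rightarrow> (real \<Rightarrow> real) \<Rightarrow> bool" where
  "wC \<Psi> a b \<rho> h \<longleftrightarrow>
     (\<exists>g. continuous_on {a..b} g \<and> (\<forall>t\<in>{a<..b}. g t = (\<Psi> t - \<Psi> a) powr (1 - \<rho>) * h t))"

text \<open>Weighted norm: max over [a,b] of the continuous extension = sup over (a,b].\<close>
definition wC_norm :: "(real \<Rightarrow> real) \<Rightarrow> real \<Rightarrow> real \<Rightarrow> real \<Rightarrow> (real \<Rightarrow> real) \<Rightarrow> real" where
  "wC_norm \<Psi> a b \<rho> h = (SUP t\<in>{a<..b}. \<bar>(\<Psi> t - \<Psi> a) powr (1 - \<rho>) * h t\<bar>)"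

definition frac_int :: "real \<Rightarrow> (real \<Rightarrow> real) \<Rightarrow> (real \<Rightarrow> real) \<Rightarrow> real \<Rightarrow> (real \<Rightarrow> real) \<Rightarrow> real \<Rightarrow> real" where
  "frac_int \<alpha> \<Psi> \<Psi>' a h t =
     (if \<alpha> = 0 then h t
      else (1 / Gamma \<alpha>) * integral {a..t} (\<lambda>\<eta>. \<Psi>' \<eta> * (\<Psi> t - \<Psi> \<eta>) powr (\<alpha> - 1) * h \<eta>))"

definition frac_integrable :: "real \<Rightarrow> (real \<Rightarrow> real) \<Rightarrow> (real \<Rightarrow> real) \<Rightarrow> real \<Rightarrow> (real \<Rightarrow> real) \<Rightarrow> real \<Rightarrow> bool" where
  "frac_integrable \<alpha> \<Psi> \<Psi>' a h t \<longleftrightarrow>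
     \<alpha> = 0 \<or> (\<lambda>\<eta>. \<Psi>' \<eta> * (\<Psi> t - \<Psi> \<eta>) powr (\<alpha> - 1) * h \<eta>) integrable_on {a..t}"

definition hilfer :: "real \<Rightarrow> real \<Rightarrow> (real \<Rightarrow> real) \<Rightarrow> (real \<Rightarrow> real) \<Rightarrow> real \<Rightarrow> real \<Rightarrow> (real \<Rightarrow> real) \<Rightarrow> real \<Rightarrow> real" where
  "hilfer \<mu> \<nu> \<Psi> \<Psi>' a b h t =
     frac_int (\<nu> * (1 - \<mu>)) \<Psi> \<Psi>' a
       (\<lambda>s. (1 / \<Psi>' s) * vector_derivative (frac_int ((1 - \<nu>) * (1 - \<mu>)) \<Psi> \<Psi>' a h) (at s within {a..b})) t"

definition hilfer_exists :: "real \<Rightarrow> real \<Rightarrow> (real \<Rightarrow> real) \<Rightarrow> (real \<Rightarrow> real) \<Rightarrow> real \<Rightarrow> real \<Rightarrow> (real \<Rightarrow> real) \<Rightarrow> bool" where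
  "hilfer_exists \<mu> \<nu> \<Psi> \<Psi>' a b h \<longleftrightarrow>
     (\<forall>s\<in>{a<..b}. frac_int ((1 - \<nu>) * (1 - \<mu>)) \<Psi> \<Psi>' a h differentiable (at s within {a..b})) \<and>
     (\<forall>t\<in>{a<..b}. frac_integrable (\<nu> * (1 - \<mu>)) \<Psi> \<Psi>' a
        (\<lambda>s. (1 / \<Psi>' s) * vector_derivative (frac_int ((1 - \<nu>) * (1 - \<mu>)) \<Psi> \<Psi>' a h) (at s within {a..b})) t)"

definition mittag_leffler :: "real \<Rightarrow> real \<Rightarrow> real" where
  "mittag_leffler \<mu> z = (\<Sum>k. z ^ k / Gamma (real k * \<mu> + 1))"

end

theory Submission
  imports Defs
begin

text \<open>
  In the variable \<open>x = \<Psi> t - \<Psi> a\<close> a weighted continuous function is \<open>x powr (\<rho> - 1) * g x\<close> with \<open>g\<close>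
  continuous, and the fractional integral \<open>I\<^sup>\<alpha>\<close> of order \<open>\<alpha>\<close> turns \<open>x powr (p - 1) * g x\<close> into
  \<open>x powr (\<alpha> + p - 1)\<close> times the Erdelyi-Kober integral of \<open>g\<close>. The latter is a bounded operator on
  continuous functions, and its semigroup law follows from the case of powers by Weierstrass
  approximation.

  Let \<open>\<beta> = \<rho> - \<mu>\<close> and let \<open>\<Phi>\<close> be the fractional integral of order \<open>1 - \<rho>\<close> of \<open>y*\<close>. The derivative of
  \<open>\<Phi>\<close> need not be Lebesgue integrable, which rules out Fubini's theorem. So the Hilfer derivative is
  first rewritten, by parts, as a Marchaud derivative of \<open>\<Phi> - \<Phi> 0\<close>; in this form it is the right-hand
  derivative of \<open>I\<^sup>\<beta> (\<Phi> - \<Phi> 0)\<close>. The hypothesis then says that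
  \<open>D = I\<^sup>\<beta> (\<Phi> - \<Phi> 0) - I\<^sup>1 f(\<cdot>, y*)\<close> is \<open>\<epsilon>\<close>-Lipschitz, that is, \<open>\<epsilon> x + D x\<close> and \<open>\<epsilon> x - D x\<close> are
  nondecreasing; since \<open>D 0 = 0\<close>, fractional integration preserves this. As \<open>I\<^sup>\<mu> D\<close> is a primitive of
  the defect of the integral equation, that defect is at most \<open>\<epsilon> * x powr \<mu> / Gamma (\<mu> + 1)\<close>.
  Finally, Picard's iteration started at \<open>y*\<close> converges to a solution, and its increments are bounded
  by the terms of the Mittag-Leffler series.
\<close>


section \<open>Monotonicity and Lipschitz bounds from derivatives\<close>

lemma real_induction_le:
  fixes f :: "real \<Rightarrow> real"
  assumes "s \<le> t" and "continuous_on {s..t} f"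
    and step: "\<And>q. s \<le> q \<Longrightarrow> q < t \<Longrightarrow> \<exists>r. q < r \<and> r \<le> t \<and> f q \<le> f r"
  shows "f s \<le> f t"
proof -
  define A where "A = {s..t} \<inter> f -` {f s..}"
  have "closed A"
    unfolding A_def using assms(2) by (intro continuous_closed_preimage) auto
  then have "compact A"
    unfolding A_def by (metis compact_Icc compact_Int_closed inf_left_idem)
  moreover have "s \<in> A"
    using assms(1) by (simp add: A_def)
  ultimately obtain q where q: "q \<in> A" and q_max: "\<And>r. r \<in> A \<Longrightarrow> r \<le> q"
    using compact_attains_sup[of A] by blast
  have "q = t"
  proof (rule ccontr)
    assume "q \<noteq> t"
    then obtain r where "q < r" "r \<le> t" "f q \<le> f r"
      using step[of q] q by (auto simp: A_def)
    moreover from this have "r \<in> A"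
      using q by (auto simp: A_def)
    ultimately show False
      using q_max by fastforce
  qed
  then show ?thesis
    using q by (simp add: A_def)
qed

lemma right_deriv_pos_imp_le:
  fixes f :: "real \<Rightarrow> real"
  assumes "x \<le> y" "continuous_on {x..y} f"
    and deriv: "\<And>q. x \<le> q \<Longrightarrow> q < y \<Longrightarrow> \<exists>d>0. (f has_real_derivative d) (at_right q)"
  shows "f x \<le> f y"
proof (rule real_induction_le[OF assms(1,2)])
  fix q assume q: "x \<le> q" "q < y"
  then obtain d where "(f has_real_derivative d) (at_right q)" "0 < d"
    using deriv by blast
  from has_real_derivative_pos_inc_right[OF this] obtain \<delta> where "0 < \<delta>"
    and \<delta>: "\<And>h. 0 < h \<Longrightarrow> h < \<delta> \<Longrightarrow> f q < f (q + h)"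
    by auto
  define h where "h = min (\<delta> / 2) (y - q)"
  have "0 < h" "h < \<delta>" "h \<le> y - q"
    using \<open>0 < \<delta>\<close> q by (auto simp: h_def)
  with \<delta>[of h] show "\<exists>r. q < r \<and> r \<le> y \<and> f q \<le> f r"
    by (intro exI[of _ "q + h"]) auto
qed

lemma mono_on_Icc_of_mono_on_Ioc:
  fixes f :: "real \<Rightarrow> real"
  assumes cont: "continuous_on {a..b} f" and mono: "mono_on {a<..b} f"
  shows "mono_on {a..b} f"
proof (rule mono_onI)
  fix x y assume xy: "x \<in> {a..b}" "y \<in> {a..b}" "x \<le> y"
  show "f x \<le> f y"
  proof (cases "a < y")
    case True
    have "continuous_on (closure {a<..<y}) f" "x \<in> closure {a<..<y}"
      using True xy by (auto simp: continuous_on_subset[OF cont])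
    then show ?thesis
      by (rule continuous_le_on_closure) (use mono_onD[OF mono] xy in auto)
  next
    case False
    then have "x = y"
      using xy by auto
    then show ?thesis
      by simp
  qed
qed

lemma mono_on_Icc_right_deriv_nonneg:
  fixes f :: "real \<Rightarrow> real"
  assumes cont: "continuous_on {a..b} f"
    and deriv: "\<And>x. x \<in> {a<..<b} \<Longrightarrow> \<exists>d\<ge>0. (f has_real_derivative d) (at_right x)"
  shows "mono_on {a..b} f"
proof -
  have perturbed: "f x + e * x \<le> f y + e * y" if "0 < e" and xy: "a < x" "x \<le> y" "y \<le> b" for x y e
  proof (rule right_deriv_pos_imp_le[OF \<open>x \<le> y\<close>])
    show "continuous_on {x..y} (\<lambda>s. f s + e * s)"
      using xy by (intro continuous_intros continuous_on_subset[OF cont]) auto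
    fix q assume "x \<le> q" "q < y"
    then obtain d where "0 \<le> d" "(f has_real_derivative d) (at_right q)"
      using deriv[of q] xy by auto
    then have "((\<lambda>s. f s + e * s) has_real_derivative d + e) (at_right q)" "0 < d + e"
      using \<open>0 < e\<close> by (auto intro!: derivative_eq_intros)
    then show "\<exists>d>0. ((\<lambda>s. f s + e * s) has_real_derivative d) (at_right q)"
      by blast
  qed
  have "f x \<le> f y" if xy: "a < x" "x \<le> y" "y \<le> b" for x y
  proof (rule field_le_epsilon)
    fix e :: real assume "0 < e"
    then have "f x + e / (b - a) * x \<le> f y + e / (b - a) * y"
      using xy by (intro perturbed divide_pos_pos) auto
    moreover have "e / (b - a) * (y - x) \<le> e / (b - a) * (b - a)"
      using xy \<open>0 < e\<close> by (intro mult_left_mono) auto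
    moreover have "e / (b - a) * (b - a) = e"
      using xy by simp
    ultimately show "f x \<le> f y + e"
      unfolding right_diff_distrib[of _ y x] by linarith
  qed
  then have "mono_on {a<..b} f"
    by (auto intro: mono_onI)
  with cont show ?thesis
    by (rule mono_on_Icc_of_mono_on_Ioc)
qed

lemma lipschitz_on_iff_mono_on:
  fixes f :: "real \<Rightarrow> real"
  assumes "0 \<le> C"
  shows "C-lipschitz_on S f \<longleftrightarrow> mono_on S (\<lambda>x. C * x + f x) \<and> mono_on S (\<lambda>x. C * x - f x)"
proof
  assume lip: "C-lipschitz_on S f"
  have bound: "\<bar>f x - f y\<bar> \<le> C * (y - x)" if "x \<in> S" "y \<in> S" "x \<le> y" for x y
    using lipschitz_onD[OF lip that(1,2)] that(3) by (simp add: dist_real_def)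
  show "mono_on S (\<lambda>x. C * x + f x) \<and> mono_on S (\<lambda>x. C * x - f x)"
    using bound by (fastforce intro: mono_onI simp: abs_le_iff right_diff_distrib)
next
  assume mono: "mono_on S (\<lambda>x. C * x + f x) \<and> mono_on S (\<lambda>x. C * x - f x)"
  show "C-lipschitz_on S f"
  proof (rule lipschitz_on_leI[OF _ assms])
    fix x y assume "x \<in> S" "y \<in> S" "x \<le> y"
    then have "C * x + f x \<le> C * y + f y" "C * x - f x \<le> C * y - f y"
      using mono by (auto dest: mono_onD)
    then show "dist (f x) (f y) \<le> C * dist x y"
      using \<open>x \<le> y\<close> by (simp add: dist_real_def abs_le_iff right_diff_distrib)
  qed
qed

lemma lipschitz_on_Icc_right_deriv_bound:
  fixes f :: "real \<Rightarrow> real"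
  assumes "0 \<le> C" and cont: "continuous_on {a..b} f"
    and deriv: "\<And>x. x \<in> {a<..<b} \<Longrightarrow> \<exists>d. \<bar>d\<bar> \<le> C \<and> (f has_real_derivative d) (at_right x)"
  shows "C-lipschitz_on {a..b} f"
proof -
  have "\<exists>d\<ge>0. ((\<lambda>x. C * x + f x) has_real_derivative d) (at_right x)"
    and "\<exists>d\<ge>0. ((\<lambda>x. C * x - f x) has_real_derivative d) (at_right x)"
    if x: "x \<in> {a<..<b}" for x
  proof -
    obtain d where d: "\<bar>d\<bar> \<le> C" "(f has_real_derivative d) (at_right x)"
      using deriv[OF x] by blast
    from d(2) have "((\<lambda>x. C * x + f x) has_real_derivative C + d) (at_right x)"
      "((\<lambda>x. C * x - f x) has_real_derivative C - d) (at_right x)"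
      by (auto intro!: derivative_eq_intros)
    moreover have "0 \<le> C + d" "0 \<le> C - d"
      using d(1) by auto
    ultimately show "\<exists>d\<ge>0. ((\<lambda>x. C * x + f x) has_real_derivative d) (at_right x)"
      "\<exists>d\<ge>0. ((\<lambda>x. C * x - f x) has_real_derivative d) (at_right x)"
      by blast+
  qed
  then show ?thesis
    unfolding lipschitz_on_iff_mono_on[OF \<open>0 \<le> C\<close>]
    by (intro conjI mono_on_Icc_right_deriv_nonneg continuous_intros cont)
qed

lemma lipschitz_at_of_has_real_derivative:
  fixes f :: "real \<Rightarrow> real"
  assumes "compact S" and cont: "continuous_on S f"
    and deriv: "(f has_real_derivative d) (at x within S)"
  obtains C where "\<And>y. y \<in> S \<Longrightarrow> \<bar>f y - f x\<bar> \<le> C * \<bar>y - x\<bar>"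
proof -
  define Q where "Q y = (if y = x then d else (f y - f x) / (y - x))" for y
  have "continuous_on S Q"
    unfolding continuous_on_def
  proof
    fix y assume y: "y \<in> S"
    show "(Q \<longlongrightarrow> Q y) (at y within S)"
    proof (cases "y = x")
      case True
      have "((\<lambda>y. (f y - f x) / (y - x)) \<longlongrightarrow> d) (at x within S)"
        using deriv by (simp add: has_field_derivative_iff)
      then have "(Q \<longlongrightarrow> d) (at x within S)"
        by (rule Lim_transform_eventually) (auto simp: Q_def eventually_at_filter)
      then show ?thesis
        using True by (simp add: Q_def)
    next
      case False
      have "((\<lambda>y. (f y - f x) / (y - x)) \<longlongrightarrow> (f y - f x) / (y - x)) (at y within S)"
        using cont y False by (intro tendsto_intros) (auto simp: continuous_on_def)
      moreover have "\<forall>\<^sub>F z in at y within S. (f z - f x) / (z - x) = Q z"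
        using eventually_neq_at_within[of x y S] by eventually_elim (simp add: Q_def)
      ultimately show ?thesis
        using False Lim_transform_eventually by (fastforce simp: Q_def)
    qed
  qed
  then have "bounded (Q ` S)"
    using \<open>compact S\<close> by (intro compact_imp_bounded compact_continuous_image)
  then obtain C where C: "\<And>y. y \<in> S \<Longrightarrow> \<bar>Q y\<bar> \<le> C"
    unfolding bounded_iff by auto
  show thesis
  proof
    fix y assume "y \<in> S"
    then have "\<bar>Q y\<bar> * \<bar>y - x\<bar> \<le> C * \<bar>y - x\<bar>"
      using C by (intro mult_right_mono) auto
    then show "\<bar>f y - f x\<bar> \<le> C * \<bar>y - x\<bar>"
      by (cases "y = x") (auto simp: Q_def abs_divide)
  qed
qed

lemma strict_mono_on_Icc_deriv_pos:
  fixes f :: "real \<Rightarrow> real"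
  assumes deriv: "\<And>x. x \<in> {a..b} \<Longrightarrow> (f has_real_derivative f' x) (at x within {a..b})"
    and pos: "\<And>x. x \<in> {a..b} \<Longrightarrow> 0 < f' x"
  shows "strict_mono_on {a..b} f"
proof (rule strict_mono_onI)
  fix r s assume rs: "r \<in> {a..b}" "s \<in> {a..b}" "r < s"
  show "f r < f s"
  proof (rule DERIV_pos_imp_increasing_open[OF \<open>r < s\<close>])
    fix x assume x: "r < x" "x < s"
    then have "(f has_real_derivative f' x) (at x)"
      using deriv[of x] rs at_within_Icc_at[of a x b] by auto
    then show "\<exists>y. (f has_real_derivative y) (at x) \<and> 0 < y"
      using pos[of x] rs x by auto
  next
    have "continuous_on {a..b} f"
      using deriv DERIV_continuous_on by blast
    then show "continuous_on {r..s} f"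
      by (rule continuous_on_subset) (use rs in auto)
  qed
qed

lemma mono_on_Icc_imp_deriv_nonneg:
  fixes f :: "real \<Rightarrow> real"
  assumes "a < b" and "mono_on {a..b} f"
    and deriv: "\<And>x. x \<in> {a..b} \<Longrightarrow> (f has_real_derivative f' x) (at x within {a..b})"
    and "continuous_on {a..b} f'" and "x \<in> {a..b}"
  shows "0 \<le> f' x"
proof (rule continuous_ge_on_closure[of "{a<..<b}" f'])
  fix s assume s: "s \<in> {a<..<b}"
  then have "(f has_real_derivative f' s) (at s)"
    using deriv[of s] at_within_Icc_at[of a s b] by auto
  then show "0 \<le> f' s"
    using mono_on_imp_deriv_nonneg[OF assms(2)] s by auto
qed (use assms in auto)


section \<open>Erdelyi-Kober integrals\<close>

definition beta_kernel :: "real \<Rightarrow> real \<Rightarrow> real \<Rightarrow> real" where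
  "beta_kernel \<alpha> p u = (1 - u) powr (\<alpha> - 1) * u powr (p - 1)"

definition gamma_ratio :: "real \<Rightarrow> real \<Rightarrow> real" where
  "gamma_ratio \<alpha> p = Gamma p / Gamma (p + \<alpha>)"

lemma gamma_ratio_pos: "0 \<le> \<alpha> \<Longrightarrow> 0 < p \<Longrightarrow> 0 < gamma_ratio \<alpha> p"
  unfolding gamma_ratio_def by (intro divide_pos_pos Gamma_real_pos) auto

lemma gamma_ratio_0: "0 < p \<Longrightarrow> gamma_ratio 0 p = 1"
  using less_imp_neq[OF Gamma_real_pos, of p] by (simp add: gamma_ratio_def)

lemma gamma_ratio_mult:
  assumes "0 \<le> \<alpha>" "0 < p"
  shows "gamma_ratio \<alpha> p * gamma_ratio \<gamma> (p + \<alpha>) = gamma_ratio (\<alpha> + \<gamma>) p"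
proof -
  have "0 < Gamma (p + \<alpha>)"
    using assms by (intro Gamma_real_pos) auto
  then show ?thesis
    by (simp add: gamma_ratio_def add.assoc)
qed

lemma has_integral_beta_kernel:
  assumes "0 < \<alpha>" "0 < p"
  shows "(beta_kernel \<alpha> p has_integral Gamma \<alpha> * gamma_ratio \<alpha> p) {0..1}"
  using has_integral_Beta_real[OF assms(2,1)]
  by (simp add: Beta_def gamma_ratio_def beta_kernel_def[abs_def] mult_ac)

lemma beta_kernel_nonneg: "0 \<le> beta_kernel \<alpha> p u"
  by (simp add: beta_kernel_def)

lemma beta_kernel_powr: "beta_kernel \<alpha> p u * u powr q = beta_kernel \<alpha> (p + q) u"
  by (simp add: beta_kernel_def powr_add[symmetric] algebra_simps)

lemma beta_kernel_mult_absolutely_integrable: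
  assumes "0 < \<alpha>" "0 < p" and cont: "continuous_on {0..1} h"
  shows "(\<lambda>u. beta_kernel \<alpha> p u * h u) absolutely_integrable_on {0..1}"
proof -
  have "beta_kernel \<alpha> p absolutely_integrable_on {0..1}"
    using has_integral_beta_kernel[OF assms(1,2)] beta_kernel_nonneg
    by (intro nonnegative_absolutely_integrable_1) (auto simp: integrable_on_def)
  then have "(\<lambda>u. h u * beta_kernel \<alpha> p u) absolutely_integrable_on {0..1}"
    using cont
    by (intro absolutely_integrable_bounded_measurable_product_real
        continuous_imp_measurable_on_sets_lebesgue compact_imp_bounded compact_continuous_image) auto
  then show ?thesis
    by (simp add: mult.commute)
qed

definition ek_int :: "real \<Rightarrow> real \<Rightarrow> (real \<Rightarrow> real) \<Rightarrow> real \<Rightarrow> real" where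
  "ek_int \<alpha> p g x =
     (if \<alpha> = 0 then g x
      else integral {0..1} (\<lambda>u. beta_kernel \<alpha> p u * g (x * u)) / Gamma \<alpha>)"

definition ek_integrable :: "real \<Rightarrow> real \<Rightarrow> (real \<Rightarrow> real) \<Rightarrow> real \<Rightarrow> bool" where
  "ek_integrable \<alpha> p g x \<longleftrightarrow>
     \<alpha> = 0 \<or> (\<lambda>u. beta_kernel \<alpha> p u * g (x * u)) integrable_on {0..1}"

lemma scaled_arg_mem_Icc:
  fixes x u :: real
  assumes "x \<in> {0..B}" "u \<in> {0..1}"
  shows "x * u \<in> {0..B}"
  using assms mult_left_mono[of u 1 x] by auto

lemma continuous_on_scaled_arg:
  fixes g :: "real \<Rightarrow> 'b::topological_space"
  assumes "continuous_on {0..B} g" "x \<in> {0..B}"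
  shows "continuous_on {0..1} (\<lambda>u. g (x * u))"
  using scaled_arg_mem_Icc[OF assms(2)]
  by (intro continuous_on_compose2[OF assms(1)] continuous_intros) auto

lemma ek_integrable_continuous:
  assumes "0 \<le> \<alpha>" "0 < p" "continuous_on {0..B} g" "x \<in> {0..B}"
  shows "ek_integrable \<alpha> p g x"
  using beta_kernel_mult_absolutely_integrable[OF _ assms(2) continuous_on_scaled_arg[OF assms(3,4)]] assms(1)
  by (force simp: ek_integrable_def intro: set_lebesgue_integral_eq_integral(1))

lemma ek_int_eq_gamma_ratio:
  assumes "0 \<le> \<alpha>" "0 < p" "0 \<le> q" and g: "\<And>u. u \<in> {0<..1} \<Longrightarrow> g (x * u) = C * u powr q"
  shows "ek_int \<alpha> p g x = C * gamma_ratio \<alpha> (p + q)" and "ek_integrable \<alpha> p g x"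
proof -
  have has_int: "((\<lambda>u. beta_kernel \<alpha> p u * g (x * u)) has_integral
      C * (Gamma \<alpha> * gamma_ratio \<alpha> (p + q))) {0..1}" if "\<alpha> \<noteq> 0"
  proof (rule has_integral_spike[of "{0}"])
    show "((\<lambda>u. C * beta_kernel \<alpha> (p + q) u) has_integral
        C * (Gamma \<alpha> * gamma_ratio \<alpha> (p + q))) {0..1}"
      using that assms by (intro has_integral_mult_right has_integral_beta_kernel) auto
  qed (use g in \<open>auto simp: beta_kernel_powr[symmetric]\<close>)
  then show "ek_integrable \<alpha> p g x"
    by (auto simp: ek_integrable_def)
  show "ek_int \<alpha> p g x = C * gamma_ratio \<alpha> (p + q)"
  proof (cases "\<alpha> = 0")
    case True
    then show ?thesis
      using g[of 1] assms by (simp add: ek_int_def gamma_ratio_0)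
  next
    case False
    then have "0 < Gamma \<alpha>"
      using assms by (intro Gamma_real_pos) auto
    with integral_unique[OF has_int[OF False]] False show ?thesis
      by (simp add: ek_int_def)
  qed
qed

lemma ek_int_power:
  assumes "0 \<le> \<alpha>" "0 < p"
  shows "ek_int \<alpha> p (\<lambda>s. s ^ k) x = gamma_ratio \<alpha> (p + k) * x ^ k"
  using ek_int_eq_gamma_ratio(1)[OF assms, of "real k" "\<lambda>s. s ^ k" x "x ^ k"]
  by (simp add: powr_realpow power_mult_distrib)

lemma ek_int_const:
  assumes "0 \<le> \<alpha>" "0 < p"
  shows "ek_int \<alpha> p (\<lambda>s. c) x = c * gamma_ratio \<alpha> p"
  using ek_int_eq_gamma_ratio(1)[OF assms, of 0 "\<lambda>s. c" x c] by simp

lemma ek_int_at_0: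
  assumes "0 \<le> \<alpha>" "0 < p"
  shows "ek_int \<alpha> p g 0 = g 0 * gamma_ratio \<alpha> p"
  using ek_int_eq_gamma_ratio(1)[OF assms, of 0 g 0 "g 0"] by simp

lemma ek_int_cmult: "ek_int \<alpha> p (\<lambda>s. c * g s) x = c * ek_int \<alpha> p g x"
  using integral_mult_right[of "{0..1}" c "\<lambda>u. beta_kernel \<alpha> p u * g (x * u)"]
  by (simp add: ek_int_def mult_ac)

lemma ek_int_add:
  assumes "ek_integrable \<alpha> p g x" "ek_integrable \<alpha> p h x"
  shows "ek_int \<alpha> p (\<lambda>s. g s + h s) x = ek_int \<alpha> p g x + ek_int \<alpha> p h x"
  using assms
  by (auto simp: ek_int_def ek_integrable_def distrib_left integral_add add_divide_distrib)

lemma ek_int_diff: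
  assumes "ek_integrable \<alpha> p g x" "ek_integrable \<alpha> p h x"
  shows "ek_int \<alpha> p (\<lambda>s. g s - h s) x = ek_int \<alpha> p g x - ek_int \<alpha> p h x"
  using assms
  by (auto simp: ek_int_def ek_integrable_def right_diff_distrib integral_diff diff_divide_distrib)

lemma ek_int_mono:
  assumes "0 \<le> \<alpha>" "ek_integrable \<alpha> p g x" "ek_integrable \<alpha> p h y"
    and bound: "\<And>u. u \<in> {0<..1} \<Longrightarrow> g (x * u) \<le> h (y * u)"
  shows "ek_int \<alpha> p g x \<le> ek_int \<alpha> p h y"
proof (cases "\<alpha> = 0")
  case True
  then show ?thesis
    using bound[of 1] by (simp add: ek_int_def)
next
  case False
  have "beta_kernel \<alpha> p u * g (x * u) \<le> beta_kernel \<alpha> p u * h (y * u)" if "u \<in> {0..1}" for u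
  proof (cases "u = 0")
    case True
    then show ?thesis
      by (simp add: beta_kernel_def)
  qed (use that bound in \<open>auto intro!: mult_left_mono beta_kernel_nonneg\<close>)
  then have "integral {0..1} (\<lambda>u. beta_kernel \<alpha> p u * g (x * u))
      \<le> integral {0..1} (\<lambda>u. beta_kernel \<alpha> p u * h (y * u))"
    using assms(2,3) False by (intro integral_le) (auto simp: ek_integrable_def)
  moreover have "0 < Gamma \<alpha>"
    using False assms(1) by (intro Gamma_real_pos) auto
  ultimately show ?thesis
    using False by (simp add: ek_int_def divide_right_mono)
qed

lemma ek_int_cong:
  assumes "0 \<le> x" "\<And>s. s \<in> {0..x} \<Longrightarrow> g s = h s"
  shows "ek_int \<alpha> p g x = ek_int \<alpha> p h x"
  using assms scaled_arg_mem_Icc[of x x] unfolding ek_int_def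
  by (auto intro!: arg_cong2[where f = "(/)"] integral_cong)

lemma ek_int_powr_mult:
  assumes "0 \<le> x"
  shows "ek_int \<alpha> p (\<lambda>s. s powr q * g s) x = x powr q * ek_int \<alpha> (p + q) g x"
proof (cases "\<alpha> = 0")
  case False
  have "integral {0..1} (\<lambda>u. beta_kernel \<alpha> p u * ((x * u) powr q * g (x * u)))
      = integral {0..1} (\<lambda>u. x powr q * (beta_kernel \<alpha> (p + q) u * g (x * u)))"
    using assms by (intro integral_cong) (auto simp: powr_mult mult_ac simp flip: beta_kernel_powr)
  then show ?thesis
    using False by (simp add: ek_int_def)
qed (simp add: ek_int_def)

lemma ek_int_abs_le:
  assumes "0 \<le> \<alpha>" "ek_integrable \<alpha> p g x" "ek_integrable \<alpha> p h y"
    and bound: "\<And>u. u \<in> {0<..1} \<Longrightarrow> \<bar>g (x * u)\<bar> \<le> h (y * u)"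
  shows "\<bar>ek_int \<alpha> p g x\<bar> \<le> ek_int \<alpha> p h y"
proof -
  have "ek_integrable \<alpha> p (\<lambda>s. (- 1) * g s) x"
    using assms(2) by (auto simp: ek_integrable_def integrable_neg_iff)
  moreover have "- 1 * g (x * u) \<le> h (y * u)" "g (x * u) \<le> h (y * u)" if "u \<in> {0<..1}" for u
    using bound[OF that] by auto
  ultimately have "ek_int \<alpha> p (\<lambda>s. (- 1) * g s) x \<le> ek_int \<alpha> p h y" "ek_int \<alpha> p g x \<le> ek_int \<alpha> p h y"
    using assms by (blast intro: ek_int_mono)+
  then show ?thesis
    unfolding ek_int_cmult by simp
qed

lemma ek_int_abs_le_const:
  assumes "0 \<le> \<alpha>" "0 < p" "ek_integrable \<alpha> p g x" "0 \<le> x"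
    and "\<And>s. s \<in> {0..x} \<Longrightarrow> \<bar>g s\<bar> \<le> C"
  shows "\<bar>ek_int \<alpha> p g x\<bar> \<le> C * gamma_ratio \<alpha> p"
proof -
  have "\<bar>ek_int \<alpha> p g x\<bar> \<le> ek_int \<alpha> p (\<lambda>s. C) x"
    using assms scaled_arg_mem_Icc[of x x]
    by (intro ek_int_abs_le assms(3) ek_integrable_continuous[of _ _ x] continuous_on_const) auto
  then show ?thesis
    using ek_int_const[OF assms(1,2)] by simp
qed

lemma ek_int_abs_le_powr:
  assumes "0 \<le> \<alpha>" "0 < p" "0 \<le> q" "ek_integrable \<alpha> p g x" "0 < x"
    and "\<And>s. s \<in> {0<..x} \<Longrightarrow> \<bar>g s\<bar> \<le> C * s powr q"
  shows "\<bar>ek_int \<alpha> p g x\<bar> \<le> C * x powr q * gamma_ratio \<alpha> (p + q)"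
proof -
  define h where "h s = C * s powr q" for s
  have h: "h (x * u) = C * x powr q * u powr q" for u
    using assms(5) by (simp add: h_def powr_mult)
  have "\<bar>ek_int \<alpha> p g x\<bar> \<le> ek_int \<alpha> p h x"
  proof (rule ek_int_abs_le)
    show "ek_integrable \<alpha> p h x"
      by (rule ek_int_eq_gamma_ratio(2)[OF assms(1-3) h])
  qed (use assms scaled_arg_mem_Icc[of x x] in \<open>auto simp: h_def mult_left_le\<close>)
  then show ?thesis
    unfolding ek_int_eq_gamma_ratio(1)[OF assms(1-3) h] .
qed

lemma ek_int_uniform_limit:
  assumes "0 \<le> \<alpha>" "0 < p" and G: "\<And>n. continuous_on {0..B} (G n)" and g: "continuous_on {0..B} g"
    and lim: "uniform_limit {0..B} G g F"
  shows "uniform_limit {0..B} (\<lambda>n. ek_int \<alpha> p (G n)) (ek_int \<alpha> p g) F"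
proof (rule uniform_limitI)
  fix e :: real assume "0 < e"
  define K where "K = gamma_ratio \<alpha> p"
  have K: "0 < K"
    using assms by (simp add: K_def gamma_ratio_pos)
  have "\<forall>\<^sub>F n in F. \<forall>s\<in>{0..B}. dist (G n s) (g s) < e / (2 * K)"
    using K \<open>0 < e\<close> by (intro uniform_limitD[OF lim]) auto
  then show "\<forall>\<^sub>F n in F. \<forall>x\<in>{0..B}. dist (ek_int \<alpha> p (G n) x) (ek_int \<alpha> p g x) < e"
  proof (eventually_elim, intro ballI)
    fix n x assume n: "\<forall>s\<in>{0..B}. dist (G n s) (g s) < e / (2 * K)" and x: "x \<in> {0..B}"
    note integrable = ek_integrable_continuous[OF assms(1,2) _ x]
    have "\<bar>ek_int \<alpha> p (G n) x - ek_int \<alpha> p g x\<bar> = \<bar>ek_int \<alpha> p (\<lambda>s. G n s - g s) x\<bar>"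
      by (simp add: ek_int_diff integrable G g)
    also have "\<dots> \<le> e / (2 * K) * gamma_ratio \<alpha> p"
      using n x assms
      by (intro ek_int_abs_le_const integrable continuous_intros) (auto simp: dist_real_def less_imp_le)
    also have "\<dots> < e"
      using K \<open>0 < e\<close> by (simp add: K_def)
    finally show "dist (ek_int \<alpha> p (G n) x) (ek_int \<alpha> p g x) < e"
      by (simp add: dist_real_def)
  qed
qed

lemma ek_int_polynomial:
  assumes "0 \<le> \<alpha>" "0 < p" "0 \<le> x"
  shows "ek_int \<alpha> p (\<lambda>s. \<Sum>i\<le>n. c i * s ^ i) x = (\<Sum>i\<le>n. c i * gamma_ratio \<alpha> (p + i) * x ^ i)"
proof (induction n)
  case 0
  show ?case
    using ek_int_const[OF assms(1,2)] by simp
next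
  case (Suc n)
  have "ek_int \<alpha> p (\<lambda>s. (\<Sum>i\<le>n. c i * s ^ i) + c (Suc n) * s ^ Suc n) x
      = ek_int \<alpha> p (\<lambda>s. \<Sum>i\<le>n. c i * s ^ i) x + ek_int \<alpha> p (\<lambda>s. c (Suc n) * s ^ Suc n) x"
    using assms
    by (intro ek_int_add ek_integrable_continuous[of _ _ x] continuous_intros) auto
  then show ?case
    using Suc.IH ek_int_power[OF assms(1,2), of "Suc n" x]
    by (simp add: ek_int_cmult[of _ _ "c (Suc n)"] del: power_Suc)
qed

lemma uniform_limit_polynomials:
  fixes g :: "real \<Rightarrow> real"
  assumes "compact S" "continuous_on S g"
  obtains c :: "nat \<Rightarrow> nat \<Rightarrow> real" and d :: "nat \<Rightarrow> nat"
  where "uniform_limit S (\<lambda>n s. \<Sum>i\<le>d n. c n i * s ^ i) g sequentially"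
proof -
  obtain P where P: "uniform_limit S P g sequentially" "\<And>n. polynomial_function (P n)"
    using Stone_Weierstrass_uniform_limit[OF assms] by blast
  have "\<exists>c d. P n = (\<lambda>s. \<Sum>i\<le>d. c i * s ^ i)" for n
    using P(2)[of n] by (auto simp: real_polynomial_function_eq[symmetric] real_polynomial_function_iff_sum)
  then obtain c d where "P n = (\<lambda>s. \<Sum>i\<le>d n. c n i * s ^ i)" for n
    by metis
  then have "P = (\<lambda>n s. \<Sum>i\<le>d n. c n i * s ^ i)"
    by blast
  then show thesis
    using P(1) that by blast
qed

lemma continuous_on_ek_int:
  assumes "0 \<le> \<alpha>" "0 < p" "continuous_on {0..B} g"
  shows "continuous_on {0..B} (ek_int \<alpha> p g)"
proof -
  obtain c d where lim: "uniform_limit {0..B} (\<lambda>n s. \<Sum>i\<le>d n. c n i * s ^ i) g sequentially"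
    using uniform_limit_polynomials[of "{0..B}" g] assms(3) by auto
  show ?thesis
  proof (rule uniform_limit_theorem)
    show "uniform_limit {0..B} (\<lambda>n. ek_int \<alpha> p (\<lambda>s. \<Sum>i\<le>d n. c n i * s ^ i)) (ek_int \<alpha> p g) sequentially"
      by (rule ek_int_uniform_limit[OF assms(1,2) _ assms(3) lim]) (intro continuous_intros)
    have "continuous_on {0..B} (\<lambda>x. \<Sum>i\<le>d n. c n i * gamma_ratio \<alpha> (p + i) * x ^ i)" for n
      by (intro continuous_intros)
    then have "continuous_on {0..B} (ek_int \<alpha> p (\<lambda>s. \<Sum>i\<le>d n. c n i * s ^ i))" for n
      by (rule continuous_on_eq) (use assms in \<open>simp add: ek_int_polynomial\<close>)
    then show "\<forall>\<^sub>F n in sequentially. continuous_on {0..B} (ek_int \<alpha> p (\<lambda>s. \<Sum>i\<le>d n. c n i * s ^ i))"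
      by simp
  qed simp
qed

lemma ek_int_semigroup_polynomial:
  assumes "0 \<le> \<alpha>" "0 \<le> \<gamma>" "0 < p" "0 \<le> x"
  shows "ek_int \<gamma> (p + \<alpha>) (ek_int \<alpha> p (\<lambda>s. \<Sum>i\<le>n. c i * s ^ i)) x
    = ek_int (\<alpha> + \<gamma>) p (\<lambda>s. \<Sum>i\<le>n. c i * s ^ i) x"
proof -
  have "ek_int \<gamma> (p + \<alpha>) (ek_int \<alpha> p (\<lambda>s. \<Sum>i\<le>n. c i * s ^ i)) x
      = ek_int \<gamma> (p + \<alpha>) (\<lambda>s. \<Sum>i\<le>n. c i * gamma_ratio \<alpha> (p + i) * s ^ i) x"
    using assms by (intro ek_int_cong ek_int_polynomial) auto
  also have "\<dots> = (\<Sum>i\<le>n. c i * (gamma_ratio \<alpha> (p + i) * gamma_ratio \<gamma> (p + i + \<alpha>)) * x ^ i)"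
    using assms by (subst ek_int_polynomial) (auto simp: ac_simps)
  also have "\<dots> = ek_int (\<alpha> + \<gamma>) p (\<lambda>s. \<Sum>i\<le>n. c i * s ^ i) x"
    using assms by (simp add: ek_int_polynomial gamma_ratio_mult)
  finally show ?thesis .
qed

lemma ek_int_semigroup:
  assumes "0 \<le> \<alpha>" "0 \<le> \<gamma>" "0 < p" and g: "continuous_on {0..B} g" and x: "x \<in> {0..B}"
  shows "ek_int \<gamma> (p + \<alpha>) (ek_int \<alpha> p g) x = ek_int (\<alpha> + \<gamma>) p g x"
proof -
  obtain c d where lim: "uniform_limit {0..B} (\<lambda>n s. \<Sum>i\<le>d n. c n i * s ^ i) g sequentially"
    using uniform_limit_polynomials[of "{0..B}" g] g by auto
  define P where "P n s = (\<Sum>i\<le>d n. c n i * s ^ i)" for n s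
  have P: "uniform_limit {0..B} P g sequentially"
    using lim by (simp add: P_def[abs_def])
  have cont_P: "continuous_on {0..B} (P n)" for n
    unfolding P_def by (intro continuous_intros)
  have "uniform_limit {0..B} (\<lambda>n. ek_int \<gamma> (p + \<alpha>) (ek_int \<alpha> p (P n)))
      (ek_int \<gamma> (p + \<alpha>) (ek_int \<alpha> p g)) sequentially"
    using assms cont_P P by (intro ek_int_uniform_limit continuous_on_ek_int) auto
  moreover have "uniform_limit {0..B} (\<lambda>n. ek_int (\<alpha> + \<gamma>) p (P n)) (ek_int (\<alpha> + \<gamma>) p g) sequentially"
    using assms cont_P P by (intro ek_int_uniform_limit) auto
  moreover have "ek_int \<gamma> (p + \<alpha>) (ek_int \<alpha> p (P n)) x = ek_int (\<alpha> + \<gamma>) p (P n) x" for n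
    unfolding P_def using assms by (intro ek_int_semigroup_polynomial) auto
  ultimately show ?thesis
    using x by (auto dest!: tendsto_uniform_limitI intro: LIMSEQ_unique)
qed

lemma continuous_on_powr_nonneg:
  fixes q :: real
  assumes "0 < q"
  shows "continuous_on {0..B} (\<lambda>x. x powr q)"
  using assms by (intro continuous_on_powr') (auto intro!: continuous_intros)

lemma continuous_on_powr_ek_int:
  assumes "0 < q" "0 \<le> \<alpha>" "0 < p" "continuous_on {0..B} g"
  shows "continuous_on {0..B} (\<lambda>x. x powr q * ek_int \<alpha> p g x)"
  using assms by (intro continuous_on_mult continuous_on_powr_nonneg continuous_on_ek_int)

lemma mono_on_powr_ek_int:
  assumes "0 \<le> \<alpha>" "0 < p" "0 \<le> q" "continuous_on {0..B} h"
    and mono: "mono_on {0..B} h" and "0 \<le> h 0"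
  shows "mono_on {0..B} (\<lambda>x. x powr q * ek_int \<alpha> p h x)"
proof (rule mono_onI)
  fix x y assume xy: "x \<in> {0..B}" "y \<in> {0..B}" "x \<le> y"
  note integrable = ek_integrable_continuous[OF assms(1,2), of B]
  have h_nonneg: "0 \<le> h s" if "s \<in> {0..B}" for s
    using mono_onD[OF mono, of 0 s] that \<open>0 \<le> h 0\<close> by auto
  have "ek_int \<alpha> p (\<lambda>s. 0) x \<le> ek_int \<alpha> p h x"
    using h_nonneg[OF scaled_arg_mem_Icc[OF xy(1)]] assms xy
    by (intro ek_int_mono integrable) simp_all
  then have "0 \<le> ek_int \<alpha> p h x"
    using ek_int_const[OF assms(1,2), of 0] by simp
  moreover have "ek_int \<alpha> p h x \<le> ek_int \<alpha> p h y"
  proof (intro ek_int_mono integrable assms(1,4) xy)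
    show "h (x * u) \<le> h (y * u)" if "u \<in> {0<..1}" for u
      using that xy by (intro mono_onD[OF mono] scaled_arg_mem_Icc mult_right_mono) auto
  qed
  ultimately show "x powr q * ek_int \<alpha> p h x \<le> y powr q * ek_int \<alpha> p h y"
    using xy assms(3) by (intro mult_mono powr_mono2) auto
qed


section \<open>Fractional integrals with respect to another function\<close>

lemma continuous_mono_image_Icc:
  fixes f :: "real \<Rightarrow> real"
  assumes "a \<le> b" "continuous_on {a..b} f" "mono_on {a..b} f"
  shows "f ` {a..b} = {f a..f b}"
proof
  show "f ` {a..b} \<subseteq> {f a..f b}"
    using mono_onD[OF assms(3)] by auto
  show "{f a..f b} \<subseteq> f ` {a..b}"
    using IVT'[of f a _ b] assms by force
qed

locale psi_scale =
  fixes a b :: real and \<Psi> \<Psi>' :: "real \<Rightarrow> real"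
  assumes ab: "a < b"
    and deriv: "\<And>t. t \<in> {a..b} \<Longrightarrow> (\<Psi> has_real_derivative \<Psi>' t) (at t within {a..b})"
    and deriv_pos: "\<And>t. t \<in> {a..b} \<Longrightarrow> 0 < \<Psi>' t"
begin

definition X :: "real \<Rightarrow> real" where
  "X t = \<Psi> t - \<Psi> a"

definition X_inv :: "real \<Rightarrow> real" where
  "X_inv = the_inv_into {a..b} X"

lemma X_a [simp]: "X a = 0"
  by (simp add: X_def)

lemma X_deriv: "t \<in> {a..b} \<Longrightarrow> (X has_real_derivative \<Psi>' t) (at t within {a..b})"
  unfolding X_def[abs_def] using deriv by (auto intro!: derivative_eq_intros)

lemma X_deriv_at: "t \<in> {a<..<b} \<Longrightarrow> (X has_real_derivative \<Psi>' t) (at t)"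
  using X_deriv[of t] at_within_Icc_at[of a t b] by auto

lemma X_strict_mono: "strict_mono_on {a..b} X"
  by (rule strict_mono_on_Icc_deriv_pos[OF X_deriv deriv_pos])

lemma X_less: "a \<le> s \<Longrightarrow> s < t \<Longrightarrow> t \<le> b \<Longrightarrow> X s < X t"
  using strict_mono_onD[OF X_strict_mono, of s t] by auto

lemma X_le: "a \<le> s \<Longrightarrow> s \<le> t \<Longrightarrow> t \<le> b \<Longrightarrow> X s \<le> X t"
  using strict_mono_on_leD[OF X_strict_mono, of s t] by auto

lemma X_pos: "t \<in> {a<..b} \<Longrightarrow> 0 < X t"
  using X_less[of a t] by simp

lemma X_mem: "t \<in> {a<..b} \<Longrightarrow> X t \<in> {0<..X b}"
  using X_pos X_le[of t b] by auto

lemma X_b_pos: "0 < X b"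
  using X_pos[of b] ab by simp

lemma continuous_on_X: "continuous_on {a..b} X"
  using X_deriv DERIV_continuous_on by blast

lemma X_image:
  assumes "t \<in> {a..b}"
  shows "X ` {a..t} = {0..X t}"
proof -
  have "continuous_on {a..t} X" "mono_on {a..t} X"
    using assms strict_mono_on_imp_mono_on[OF X_strict_mono]
    by (auto intro: continuous_on_subset[OF continuous_on_X] mono_on_subset)
  then show ?thesis
    using continuous_mono_image_Icc[of a t X] assms by simp
qed

lemma X_image_b: "X ` {a..b} = {0..X b}"
  using X_image[of b] ab by simp

lemma inj_on_X: "inj_on X {a..b}"
  using X_strict_mono by (rule strict_mono_on_imp_inj_on)

lemma X_inv_X: "t \<in> {a..b} \<Longrightarrow> X_inv (X t) = t"
  unfolding X_inv_def by (rule the_inv_into_f_f[OF inj_on_X])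

lemma X_X_inv: "x \<in> {0..X b} \<Longrightarrow> X (X_inv x) = x"
  unfolding X_inv_def using f_the_inv_into_f[OF inj_on_X] X_image_b by blast

lemma X_inv_mem: "x \<in> {0..X b} \<Longrightarrow> X_inv x \<in> {a..b}"
  unfolding X_inv_def using the_inv_into_into[OF inj_on_X] X_image_b by blast

lemma continuous_on_X_inv: "continuous_on {0..X b} X_inv"
  using continuous_on_inv[of "{a..b}" X X_inv] continuous_on_X X_inv_X X_image_b by auto

lemma Ioc_X_cases:
  assumes "x \<in> {0<..X b}"
  obtains t where "t \<in> {a<..b}" "x = X t"
proof
  have "X_inv x \<in> {a..b}" "X (X_inv x) = x"
    using X_inv_mem[of x] X_X_inv[of x] assms by auto
  moreover from this have "X_inv x \<noteq> a"
    using assms by auto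
  ultimately show "X_inv x \<in> {a<..b}" "x = X (X_inv x)"
    by auto
qed

lemma Ioo_X_cases:
  assumes "x \<in> {0<..<X b}"
  obtains t where "t \<in> {a<..<b}" "x = X t"
proof -
  obtain t where t: "t \<in> {a<..b}" "x = X t"
    using Ioc_X_cases[of x] assms by auto
  moreover from this have "t \<noteq> b"
    using assms by auto
  ultimately show thesis
    using that[of t] by auto
qed

lemma continuous_on_comp_X:
  assumes "continuous_on {0..X b} g"
  shows "continuous_on {a..b} (\<lambda>t. g (X t))"
  using continuous_on_compose2[OF assms continuous_on_X] X_image_b by auto

lemma has_real_derivative_in_X:
  assumes t: "t \<in> {a<..<b}" and "((\<lambda>s. \<Phi> (X s)) has_real_derivative d) (at t)"
  shows "(\<Phi> has_real_derivative d / \<Psi>' t) (at (X t))"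
proof -
  have x: "0 < X t" "X t < X b" and inv: "X_inv (X t) = t"
    using X_pos[of t] X_less[of t b] X_inv_X[of t] t by auto
  have "isCont X_inv (X t)"
    using continuous_on_interior[OF continuous_on_X_inv, of "X t"] x by simp
  then have "(X_inv has_real_derivative inverse (\<Psi>' t)) (at (X t))"
    using x inv X_deriv_at[OF t] deriv_pos[of t] t X_X_inv
    by (intro DERIV_inverse_function[where f = X and a = 0 and b = "X b"]) auto
  moreover have "((\<lambda>s. \<Phi> (X s)) has_real_derivative d) (at (X_inv (X t)))"
    using assms(2) inv by simp
  ultimately have "((\<lambda>x. \<Phi> (X (X_inv x))) has_real_derivative d * inverse (\<Psi>' t)) (at (X t))"
    by (rule DERIV_chain2[rotated])
  then have "(\<Phi> has_real_derivative d * inverse (\<Psi>' t)) (at (X t))"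
    by (rule has_field_derivative_transform_within_open[where S = "{0<..<X b}"]) (use x X_X_inv in auto)
  then show ?thesis
    by (simp add: divide_inverse)
qed

lemma has_integral_rescaled_X:
  assumes t: "t \<in> {a<..b}" and F: "F absolutely_integrable_on {0..1}"
  shows "((\<lambda>s. \<Psi>' s / X t * F (X s / X t)) has_integral integral {0..1} F) {a..t}"
proof -
  define \<phi> where "\<phi> s = X s / X t" for s
  note Xt = X_pos[OF t]
  have "\<phi> ` {a..t} = (\<lambda>x. x / X t) ` (X ` {a..t})"
    by (simp add: \<phi>_def image_image)
  then have img: "\<phi> ` {a..t} = {0..1}"
    using X_image[of t] t Xt by simp
  have \<phi>_deriv: "(\<phi> has_field_derivative \<Psi>' s / X t) (at s within {a..t})" if "s \<in> {a..t}" for s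
    unfolding \<phi>_def using that t by (intro DERIV_cdivide DERIV_subset[OF X_deriv]) auto
  have "inj_on \<phi> {a..t}"
    using inj_on_subset[OF inj_on_X, of "{a..t}"] t Xt by (auto simp: \<phi>_def inj_on_def)
  then have "(\<lambda>s. \<bar>\<Psi>' s / X t\<bar> * F (\<phi> s)) absolutely_integrable_on {a..t} \<and>
      integral {a..t} (\<lambda>s. \<bar>\<Psi>' s / X t\<bar> * F (\<phi> s)) = integral {0..1} F"
    using has_absolute_integral_change_of_variables_1'[of "{a..t}" \<phi> "\<lambda>s. \<Psi>' s / X t" F, OF _ \<phi>_deriv]
      img F by auto
  then have "((\<lambda>s. \<bar>\<Psi>' s / X t\<bar> * F (\<phi> s)) has_integral integral {0..1} F) {a..t}"
    by (metis has_integral_integral set_lebesgue_integral_eq_integral(1))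
  then show ?thesis
    by (rule has_integral_eq[rotated])
      (use deriv_pos t Xt in \<open>auto simp: \<phi>_def abs_mult abs_of_pos\<close>)
qed

lemma has_integral_frac_kernel:
  assumes t: "t \<in> {a<..b}" and "0 < \<alpha>" "0 < p" and g: "continuous_on {0..X t} g"
    and h: "\<And>s. s \<in> {a<..t} \<Longrightarrow> h s = X s powr (p - 1) * g (X s)"
  shows "((\<lambda>s. \<Psi>' s * (\<Psi> t - \<Psi> s) powr (\<alpha> - 1) * h s) has_integral
    Gamma \<alpha> * (X t powr (\<alpha> + p - 1) * ek_int \<alpha> p g (X t))) {a..t}"
proof -
  define F where "F u = beta_kernel \<alpha> p u * g (X t * u)" for u
  note Xt = X_pos[OF t]
  have integrand: "\<Psi>' s * (\<Psi> t - \<Psi> s) powr (\<alpha> - 1) * h s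
      = X t powr (\<alpha> + p - 1) * (\<Psi>' s / X t * F (X s / X t))"
    if "s \<in> {a..t} - {a}" for s
  proof -
    have Xs: "0 < X s" "X s \<le> X t" and h_s: "h s = X s powr (p - 1) * g (X s)"
      using X_pos[of s] X_le[of s t] h[of s] that t by auto
    have "1 - X s / X t = (\<Psi> t - \<Psi> s) / X t"
      using Xt by (auto simp: X_def field_simps)
    then have F_s: "F (X s / X t) = ((\<Psi> t - \<Psi> s) powr (\<alpha> - 1) / X t powr (\<alpha> - 1))
        * (X s powr (p - 1) / X t powr (p - 1)) * g (X s)"
      using Xs Xt by (simp add: F_def beta_kernel_def powr_divide X_def)
    have "X t powr (\<alpha> + p - 1) = X t powr ((\<alpha> - 1) + (p - 1) + 1)"
      by (simp add: algebra_simps)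
    also have "\<dots> = X t powr (\<alpha> - 1) * X t powr (p - 1) * X t"
      using Xt by (simp only: powr_add powr_one)
    finally show ?thesis
      unfolding h_s F_s using Xt by (simp add: field_simps)
  qed
  have "F absolutely_integrable_on {0..1}"
    unfolding F_def using assms(2,3) Xt
    by (intro beta_kernel_mult_absolutely_integrable continuous_on_scaled_arg[OF g]) auto
  then have "((\<lambda>s. X t powr (\<alpha> + p - 1) * (\<Psi>' s / X t * F (X s / X t))) has_integral
      X t powr (\<alpha> + p - 1) * integral {0..1} F) {a..t}"
    by (intro has_integral_mult_right has_integral_rescaled_X[OF t])
  moreover have "integral {0..1} F = Gamma \<alpha> * ek_int \<alpha> p g (X t)"
    using \<open>0 < \<alpha>\<close> less_imp_neq[OF Gamma_real_pos, of \<alpha>] by (simp add: ek_int_def F_def[abs_def])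
  ultimately have "((\<lambda>s. X t powr (\<alpha> + p - 1) * (\<Psi>' s / X t * F (X s / X t))) has_integral
      Gamma \<alpha> * (X t powr (\<alpha> + p - 1) * ek_int \<alpha> p g (X t))) {a..t}"
    by (simp only: mult.left_commute)
  then show ?thesis
    by (rule has_integral_spike[OF negligible_sing[of a], rotated]) (rule integrand)
qed

lemma frac_int_eq_ek_int:
  assumes "t \<in> {a<..b}" "0 \<le> \<alpha>" "0 < p" "continuous_on {0..X t} g"
    and h: "\<And>s. s \<in> {a<..t} \<Longrightarrow> h s = X s powr (p - 1) * g (X s)"
  shows "frac_int \<alpha> \<Psi> \<Psi>' a h t = X t powr (\<alpha> + p - 1) * ek_int \<alpha> p g (X t)"
proof (cases "\<alpha> = 0")
  case True
  then show ?thesis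
    using assms by (simp add: frac_int_def ek_int_def)
next
  case False
  then have "0 < \<alpha>"
    using assms by simp
  from integral_unique[OF has_integral_frac_kernel[OF assms(1) this assms(3-5)]] Gamma_real_pos[OF this]
  show ?thesis
    using False by (simp add: frac_int_def)
qed

definition profile :: "real \<Rightarrow> (real \<Rightarrow> real) \<Rightarrow> (real \<Rightarrow> real) \<Rightarrow> bool" where
  "profile \<rho> h g \<longleftrightarrow>
     continuous_on {0..X b} g \<and> (\<forall>t\<in>{a<..b}. h t = X t powr (\<rho> - 1) * g (X t))"

lemma profile_continuous: "profile \<rho> h g \<Longrightarrow> continuous_on {0..X b} g"
  by (simp add: profile_def)

lemma profile_eq: "profile \<rho> h g \<Longrightarrow> t \<in> {a<..b} \<Longrightarrow> h t = X t powr (\<rho> - 1) * g (X t)"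
  by (simp add: profile_def)

lemma profile_weighted_eq:
  assumes "profile \<rho> h g" and t: "t \<in> {a<..b}"
  shows "X t powr (1 - \<rho>) * h t = g (X t)"
  using profile_eq[OF assms] X_pos[OF t] by (simp flip: powr_add mult.assoc)

lemma wC_iff_profile: "wC \<Psi> a b \<rho> h \<longleftrightarrow> (\<exists>g. profile \<rho> h g)"
proof
  assume "wC \<Psi> a b \<rho> h"
  then obtain g where g: "continuous_on {a..b} g" "\<forall>t\<in>{a<..b}. g t = X t powr (1 - \<rho>) * h t"
    unfolding wC_def X_def by blast
  have "continuous_on {0..X b} (\<lambda>x. g (X_inv x))"
    using X_inv_mem by (intro continuous_on_compose2[OF g(1) continuous_on_X_inv]) auto
  moreover have "h t = X t powr (\<rho> - 1) * g (X_inv (X t))" if t: "t \<in> {a<..b}" for t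
    using g(2) t X_inv_X[of t] X_pos[OF t] by (simp flip: powr_add mult.assoc)
  ultimately show "\<exists>g. profile \<rho> h g"
    by (auto simp: profile_def)
next
  assume "\<exists>g. profile \<rho> h g"
  then obtain g where g: "profile \<rho> h g" ..
  have "continuous_on {a..b} (\<lambda>t. g (X t))"
    by (rule continuous_on_comp_X[OF profile_continuous[OF g]])
  moreover have "g (X t) = (\<Psi> t - \<Psi> a) powr (1 - \<rho>) * h t" if "t \<in> {a<..b}" for t
    using profile_weighted_eq[OF g that] by (simp add: X_def)
  ultimately show "wC \<Psi> a b \<rho> h"
    unfolding wC_def by blast
qed

lemma frac_int_profile:
  assumes "profile \<rho> h g" "0 < \<rho>" "0 \<le> \<alpha>" and t: "t \<in> {a<..b}"
  shows "frac_int \<alpha> \<Psi> \<Psi>' a h t = X t powr (\<alpha> + \<rho> - 1) * ek_int \<alpha> \<rho> g (X t)"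
proof (rule frac_int_eq_ek_int)
  show "continuous_on {0..X t} g"
    using profile_continuous[OF assms(1)] X_mem[OF t] by (auto elim: continuous_on_subset)
qed (use assms profile_eq[OF assms(1)] in auto)

lemma wC_norm_profile_diff_le:
  assumes y: "profile \<rho> y g" and z: "profile \<rho> z h"
    and bound: "\<And>x. x \<in> {0..X b} \<Longrightarrow> \<bar>g x - h x\<bar> \<le> C"
  shows "wC_norm \<Psi> a b \<rho> (\<lambda>t. y t - z t) \<le> C"
  unfolding wC_norm_def
proof (rule cSUP_least)
  show "{a<..b} \<noteq> {}"
    using ab by auto
  fix t assume t: "t \<in> {a<..b}"
  have "X t powr (1 - \<rho>) * (y t - z t) = g (X t) - h (X t)"
    using profile_weighted_eq[OF y t] profile_weighted_eq[OF z t] by (simp add: right_diff_distrib)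
  then show "\<bar>(\<Psi> t - \<Psi> a) powr (1 - \<rho>) * (y t - z t)\<bar> \<le> C"
    using bound[of "X t"] X_mem[OF t] by (simp add: X_def)
qed

lemma frac_int_tendsto_at_right:
  assumes y: "profile \<rho> y g" and \<rho>: "0 < \<rho>" "\<rho> \<le> 1"
  shows "(frac_int (1 - \<rho>) \<Psi> \<Psi>' a y \<longlongrightarrow> Gamma \<rho> * g 0) (at_right a)"
proof -
  define \<Phi> where "\<Phi> = ek_int (1 - \<rho>) \<rho> g"
  have "continuous_on {a..b} (\<lambda>t. \<Phi> (X t))"
    unfolding \<Phi>_def using \<rho> profile_continuous[OF y]
    by (intro continuous_on_comp_X continuous_on_ek_int) auto
  then have "((\<lambda>t. \<Phi> (X t)) \<longlongrightarrow> \<Phi> (X a)) (at a within {a..b})"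
    using ab by (auto simp: continuous_on_def simp del: X_a)
  moreover have "\<Phi> (X a) = Gamma \<rho> * g 0"
    using ek_int_at_0[of "1 - \<rho>" \<rho> g] \<rho> by (simp add: \<Phi>_def gamma_ratio_def)
  ultimately have "((\<lambda>t. \<Phi> (X t)) \<longlongrightarrow> Gamma \<rho> * g 0) (at_right a)"
    using at_within_Icc_at_right[OF ab] by simp
  moreover have "\<Phi> (X t) = frac_int (1 - \<rho>) \<Psi> \<Psi>' a y t" if "t \<in> {a<..<b}" for t
    using frac_int_profile[OF y \<rho>(1), of "1 - \<rho>" t] X_pos[of t] that \<rho> by (simp add: \<Phi>_def)
  then have "\<forall>\<^sub>F t in at_right a. \<Phi> (X t) = frac_int (1 - \<rho>) \<Psi> \<Psi>' a y t"
    using ab by (auto simp: eventually_at_right[OF ab])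
  ultimately show ?thesis
    by (rule Lim_transform_eventually)
qed

end


section \<open>Marchaud derivatives\<close>

definition marchaud_deriv :: "real \<Rightarrow> (real \<Rightarrow> real) \<Rightarrow> real \<Rightarrow> real" where
  "marchaud_deriv \<alpha> f x =
     (x powr (- \<alpha>) * f x + \<alpha> * integral {0..x} (\<lambda>s. (x - s) powr (- \<alpha> - 1) * (f x - f s)))
       / Gamma (1 - \<alpha>)"

lemma integral_has_real_derivative_at:
  fixes f :: "real \<Rightarrow> real"
  assumes "f integrable_on {a..b}" and x: "x \<in> {a<..<b}" and "isCont f x"
  shows "((\<lambda>y. integral {a..y} f) has_real_derivative f x) (at x)"
proof -
  have "continuous (at x within {a..b} - {}) f"
    using continuous_at_imp_continuous_at_within[OF assms(3)] by simp
  then have "((\<lambda>y. integral {a..y} f) has_real_derivative f x) (at x within {a..b})"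
    using integral_has_vector_derivative_continuous_at[OF assms(1), of x "{}"] x
    by (simp add: has_real_derivative_iff_has_vector_derivative)
  then show ?thesis
    using at_within_Icc_at[of a x b] x by simp
qed

lemma Gamma_real_plus1:
  fixes x :: real
  assumes "0 < x"
  shows "Gamma (x + 1) = x * Gamma x"
  using assms nonpos_Ints_nonpos[of x] by (intro Gamma_plus1) force

lemma has_integral_rl_kernel:
  assumes "0 < x" "0 < \<alpha>" "0 < p" "continuous_on {0..x} g"
    and "\<And>s. s \<in> {0<..x} \<Longrightarrow> h s = s powr (p - 1) * g s"
  shows "((\<lambda>s. (x - s) powr (\<alpha> - 1) * h s) has_integral
    Gamma \<alpha> * (x powr (\<alpha> + p - 1) * ek_int \<alpha> p g x)) {0..x}"
proof -
  interpret psi_scale 0 x "\<lambda>s. s" "\<lambda>s. 1"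
    by unfold_locales (use assms in auto)
  show ?thesis
    using has_integral_frac_kernel[of x \<alpha> p g h] assms by (simp add: X_def)
qed

lemma ek_int_1_has_derivative:
  assumes "0 < p" and cont: "continuous_on {0..B} g" and x: "x \<in> {0<..<B}"
  shows "((\<lambda>x. x powr p * ek_int 1 p g x) has_real_derivative x powr (p - 1) * g x) (at x)"
proof -
  define h where "h s = s powr (p - 1) * g s" for s
  have has_int: "(h has_integral y powr p * ek_int 1 p g y) {0..y}" if y: "y \<in> {0<..B}" for y
  proof (rule has_integral_spike[of "{y}"])
    show "((\<lambda>s. (y - s) powr (1 - 1) * h s) has_integral y powr p * ek_int 1 p g y) {0..y}"
      using has_integral_rl_kernel[of y 1 p g h] y assms(1) continuous_on_subset[OF cont, of "{0..y}"]
      by (simp add: h_def)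
  qed auto
  have "isCont g x"
    using continuous_on_interior[OF cont, of x] x by simp
  then have "isCont h x"
    unfolding h_def using x by (intro continuous_intros) auto
  then have "((\<lambda>y. integral {0..y} h) has_real_derivative h x) (at x)"
    using has_int[of B] x by (intro integral_has_real_derivative_at) auto
  then have "((\<lambda>x. x powr p * ek_int 1 p g x) has_real_derivative h x) (at x)"
    by (rule has_field_derivative_transform_within_open[where S = "{0<..<B}"])
      (use x has_int in \<open>auto intro!: integral_unique\<close>)
  then show ?thesis
    by (simp add: h_def)
qed

lemma has_integral_powr_kernel:
  fixes x :: real
  assumes "a \<le> x" "\<alpha> < 1"
  shows "((\<lambda>s. (x - s) powr (- \<alpha>)) has_integral (x - a) powr (1 - \<alpha>) / (1 - \<alpha>)) {a..x}"
proof -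
  define G where "G s = - ((x - s) powr (1 - \<alpha>)) / (1 - \<alpha>)" for s
  have "((\<lambda>s. (x - s) powr (- \<alpha>)) has_integral G x - G a) {a..x}"
  proof (rule fundamental_theorem_of_calculus_interior[OF assms(1)])
    show "continuous_on {a..x} G"
      unfolding G_def using assms(2) by (intro continuous_intros continuous_on_powr') auto
    fix s assume "s \<in> {a<..<x}"
    then have "(G has_real_derivative (x - s) powr (- \<alpha>)) (at s)"
      unfolding G_def using assms(2) by (auto intro!: derivative_eq_intros)
    then show "(G has_vector_derivative (x - s) powr (- \<alpha>)) (at s)"
      by (simp add: has_real_derivative_iff_has_vector_derivative)
  qed
  then show ?thesis
    by (simp add: G_def)
qed

lemma powr_kernel_absolutely_integrable:
  fixes x :: real
  assumes "a \<le> x" "\<alpha> < 1"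
  shows "(\<lambda>s. (x - s) powr (- \<alpha>)) absolutely_integrable_on {a..x}"
  using has_integral_powr_kernel[OF assms]
  by (intro nonnegative_absolutely_integrable_1) (auto simp: integrable_on_def)

lemma powr_kernel_mult_integrable:
  fixes f :: "real \<Rightarrow> real"
  assumes "a \<le> x" "\<alpha> < 1" "continuous_on {a..x} f"
  shows "(\<lambda>s. (x - s) powr (- \<alpha>) * f s) integrable_on {a..x}"
proof -
  have "(\<lambda>s. f s * (x - s) powr (- \<alpha>)) absolutely_integrable_on {a..x}"
    using assms
    by (intro absolutely_integrable_bounded_measurable_product_real powr_kernel_absolutely_integrable
        continuous_imp_measurable_on_sets_lebesgue compact_imp_bounded compact_continuous_image) auto
  then show ?thesis
    by (simp add: mult.commute set_lebesgue_integral_eq_integral(1))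
qed

lemma marchaud_kernel_integrable:
  fixes f :: "real \<Rightarrow> real"
  assumes "a \<le> x" "\<alpha> < 1" and cont: "continuous_on {a..x} f"
    and bound: "\<And>s. s \<in> {a..x} \<Longrightarrow> \<bar>f s\<bar> \<le> C * (x - s)"
  shows "(\<lambda>s. (x - s) powr (- \<alpha> - 1) * f s) integrable_on {a..x}"
proof -
  have "(\<lambda>s. f s / (x - s)) \<in> borel_measurable (lebesgue_on {a..x})"
    using cont
    by (intro borel_measurable_divide continuous_imp_measurable_on_sets_lebesgue continuous_intros) auto
  moreover have "\<bar>f s / (x - s)\<bar> \<le> \<bar>C\<bar>" if "s \<in> {a..x}" for s
  proof (cases "s = x")
    case False
    then have "\<bar>f s\<bar> \<le> \<bar>C\<bar> * (x - s)"
      using bound[OF that] that by (auto intro: order_trans mult_right_mono)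
    then show ?thesis
      using False that by (simp add: abs_divide divide_le_eq)
  qed simp
  then have "bounded ((\<lambda>s. f s / (x - s)) ` {a..x})"
    unfolding bounded_iff by (intro exI[of _ "\<bar>C\<bar>"]) auto
  ultimately have "(\<lambda>s. f s / (x - s) * (x - s) powr (- \<alpha>)) absolutely_integrable_on {a..x}"
    using assms(1,2)
    by (intro absolutely_integrable_bounded_measurable_product_real powr_kernel_absolutely_integrable) auto
  moreover have "f s / (x - s) * (x - s) powr (- \<alpha>) = (x - s) powr (- \<alpha> - 1) * f s"
    if "s \<in> {a..x}" for s
    using that by (cases "s = x") (auto simp: powr_diff)
  ultimately show ?thesis
    by (metis (no_types, lifting) integrable_eq set_lebesgue_integral_eq_integral(1))
qed

lemma abs_powr_diff_le:
  fixes u v \<alpha> :: real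
  assumes "0 < \<alpha>" "0 < u" "u < v"
  shows "\<bar>v powr (- \<alpha>) - u powr (- \<alpha>)\<bar> \<le> (v - u) * (\<alpha> * u powr (- \<alpha> - 1))"
proof -
  have "\<exists>z. u < z \<and> z < v \<and> v powr (- \<alpha>) - u powr (- \<alpha>) = (v - u) * (- \<alpha> * z powr (- \<alpha> - 1))"
    using assms by (intro MVT2) (auto intro!: derivative_eq_intros)
  then obtain z where z: "u < z" "v powr (- \<alpha>) - u powr (- \<alpha>) = (v - u) * (- \<alpha> * z powr (- \<alpha> - 1))"
    by blast
  have "\<bar>v powr (- \<alpha>) - u powr (- \<alpha>)\<bar> = (v - u) * (\<alpha> * z powr (- \<alpha> - 1))"
    unfolding z(2) using assms by (simp add: abs_mult)
  also have "\<dots> \<le> (v - u) * (\<alpha> * u powr (- \<alpha> - 1))"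
    using z assms by (intro mult_left_mono powr_mono2') auto
  finally show ?thesis .
qed

lemma has_right_derivative_integral_dominated:
  fixes k :: "real \<Rightarrow> 'n::euclidean_space \<Rightarrow> real"
  assumes int: "\<And>y. x \<le> y \<Longrightarrow> k y integrable_on S" and "h integrable_on S"
    and bound: "\<And>y s. x < y \<Longrightarrow> s \<in> S \<Longrightarrow> \<bar>k y s - k x s\<bar> \<le> (y - x) * h s"
    and deriv: "\<And>s. s \<in> S \<Longrightarrow> ((\<lambda>y. k y s) has_real_derivative k' s) (at_right x)"
  shows "((\<lambda>y. integral S (k y)) has_real_derivative integral S k') (at_right x)"
proof -
  define q where "q y s = (k y s - k x s) / (y - x)" for y s
  have "((\<lambda>y. integral S (q y)) \<longlongrightarrow> integral S k') (at_right x)"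
    unfolding tendsto_at_iff_sequentially comp_def
  proof (intro allI impI)
    fix r :: "nat \<Rightarrow> real" assume r: "\<forall>i. r i \<in> {x<..} - {x}" "r \<longlonglongrightarrow> x"
    show "(\<lambda>i. integral S (q (r i))) \<longlonglongrightarrow> integral S k'"
    proof (rule dominated_convergence(2))
      show "q (r i) integrable_on S" for i
        unfolding q_def using r(1)
        by (intro integrable_on_divide integrable_diff int) (auto simp: less_imp_le)
      show "norm (q (r i) s) \<le> h s" if "s \<in> S" for i s
        using bound[OF _ that, of "r i"] spec[OF r(1), of i]
        by (auto simp: q_def abs_divide divide_le_eq mult.commute)
      show "(\<lambda>i. q (r i) s) \<longlonglongrightarrow> k' s" if "s \<in> S" for s
        using deriv[OF that] r
        unfolding has_field_derivative_iff tendsto_at_iff_sequentially comp_def q_def by blast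
    qed fact
  qed
  moreover have "\<forall>\<^sub>F y in at_right x. integral S (q y) = (integral S (k y) - integral S (k x)) / (y - x)"
    using eventually_at_right_less[of x]
    by eventually_elim (simp add: q_def[abs_def] integral_diff int)
  ultimately show ?thesis
    unfolding has_field_derivative_iff by (rule Lim_transform_eventually)
qed

text \<open>Increments to the right keep the difference quotients of the kernel below its derivative at \<open>x\<close>,
  which is integrable against \<open>f\<close>.\<close>

lemma has_right_derivative_kernel_integral:
  fixes f :: "real \<Rightarrow> real"
  assumes "a \<le> x" and \<alpha>: "0 < \<alpha>" "\<alpha> < 1" and cont: "continuous_on {a..x} f"
    and bound: "\<And>s. s \<in> {a..x} \<Longrightarrow> \<bar>f s\<bar> \<le> C * (x - s)"
  shows "((\<lambda>y. integral {a..x} (\<lambda>s. (y - s) powr (- \<alpha>) * f s)) has_real_derivative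
    integral {a..x} (\<lambda>s. - \<alpha> * (x - s) powr (- \<alpha> - 1) * f s)) (at_right x)"
proof (rule has_right_derivative_integral_dominated)
  have "f x = 0"
    using bound[of x] assms(1) by simp
  show "(\<lambda>s. (y - s) powr (- \<alpha>) * f s) integrable_on {a..x}" if "x \<le> y" for y
  proof (cases "y = x")
    case False
    then show ?thesis
      using that by (intro integrable_continuous_interval continuous_intros cont) auto
  qed (use powr_kernel_mult_integrable[OF assms(1) \<alpha>(2) cont] in simp)
  show "(\<lambda>s. \<alpha> * C * (x - s) powr (- \<alpha>)) integrable_on {a..x}"
    using has_integral_mult_right[OF has_integral_powr_kernel[OF assms(1) \<alpha>(2)]] by blast
  fix s assume s: "s \<in> {a..x}"
  show "\<bar>(y - s) powr (- \<alpha>) * f s - (x - s) powr (- \<alpha>) * f s\<bar> \<le> (y - x) * (\<alpha> * C * (x - s) powr (- \<alpha>))"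
    if "x < y" for y
  proof (cases "s = x")
    case False
    then have xs: "0 < x - s" "x - s < y - s"
      using s that by auto
    have "\<bar>(y - s) powr (- \<alpha>) * f s - (x - s) powr (- \<alpha>) * f s\<bar>
        = \<bar>(y - s) powr (- \<alpha>) - (x - s) powr (- \<alpha>)\<bar> * \<bar>f s\<bar>"
      by (simp flip: left_diff_distrib abs_mult)
    also have "\<dots> \<le> (y - x) * (\<alpha> * (x - s) powr (- \<alpha> - 1)) * (C * (x - s))"
      using abs_powr_diff_le[OF \<alpha>(1) xs] bound[OF s] \<alpha>(1) that by (intro mult_mono) auto
    also have "\<dots> = (y - x) * (\<alpha> * C * (x - s) powr (- \<alpha>))"
      using xs by (simp add: powr_diff)
    finally show ?thesis .
  qed (simp add: \<open>f x = 0\<close>)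
  show "((\<lambda>y. (y - s) powr (- \<alpha>) * f s) has_real_derivative - \<alpha> * (x - s) powr (- \<alpha> - 1) * f s) (at_right x)"
  proof (cases "s = x")
    case False
    then show ?thesis
      using s by (auto intro!: derivative_eq_intros)
  qed (simp add: \<open>f x = 0\<close>)
qed

lemma abs_powr_kernel_integral_le:
  fixes f :: "real \<Rightarrow> real"
  assumes "x \<le> y" "\<alpha> < 1" "0 \<le> C" and "continuous_on {x..y} f"
    and bound: "\<And>s. s \<in> {x..y} \<Longrightarrow> \<bar>f s\<bar> \<le> C * (s - x)"
  shows "\<bar>integral {x..y} (\<lambda>s. (y - s) powr (- \<alpha>) * f s)\<bar> \<le> C * (y - x) * ((y - x) powr (1 - \<alpha>) / (1 - \<alpha>))"
proof -
  note kernel = has_integral_mult_right[OF has_integral_powr_kernel[OF assms(1,2)], of "C * (y - x)"]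
  have "norm (integral {x..y} (\<lambda>s. (y - s) powr (- \<alpha>) * f s))
      \<le> integral {x..y} (\<lambda>s. C * (y - x) * (y - s) powr (- \<alpha>))"
  proof (rule integral_norm_bound_integral)
    show "(\<lambda>s. (y - s) powr (- \<alpha>) * f s) integrable_on {x..y}"
      using assms by (intro powr_kernel_mult_integrable) auto
    show "(\<lambda>s. C * (y - x) * (y - s) powr (- \<alpha>)) integrable_on {x..y}"
      using kernel by blast
    fix s assume s: "s \<in> {x..y}"
    then have "\<bar>f s\<bar> \<le> C * (s - x)"
      by (rule bound)
    also have "\<dots> \<le> C * (y - x)"
      using s \<open>0 \<le> C\<close> by (intro mult_left_mono) auto
    finally show "norm ((y - s) powr (- \<alpha>) * f s) \<le> C * (y - x) * (y - s) powr (- \<alpha>)"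
      by (simp add: abs_mult mult_right_mono mult.commute)
  qed
  then show ?thesis
    using integral_unique[OF kernel] by simp
qed

lemma has_right_derivative_kernel_integral_upper:
  fixes f :: "real \<Rightarrow> real"
  assumes "x < b" and "\<alpha> < 1" and cont: "continuous_on {x..b} f"
    and bound: "\<And>s. s \<in> {x..b} \<Longrightarrow> \<bar>f s\<bar> \<le> C * (s - x)"
  shows "((\<lambda>y. integral {x..y} (\<lambda>s. (y - s) powr (- \<alpha>) * f s)) has_real_derivative 0) (at_right x)"
proof -
  define I where "I y = integral {x..y} (\<lambda>s. (y - s) powr (- \<alpha>) * f s)" for y
  have "0 \<le> C"
    using order_trans[OF abs_ge_zero bound[of b]] assms(1) by (simp add: zero_le_mult_iff)
  have I_bound: "norm ((I y - I x) / (y - x)) \<le> C * ((y - x) powr (1 - \<alpha>) / (1 - \<alpha>))"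
    if y: "y \<in> {x<..<b}" for y
  proof -
    have "\<bar>I y\<bar> \<le> C * (y - x) * ((y - x) powr (1 - \<alpha>) / (1 - \<alpha>))"
      unfolding I_def using y assms \<open>0 \<le> C\<close> continuous_on_subset[OF cont, of "{x..y}"]
      by (intro abs_powr_kernel_integral_le) auto
    then show ?thesis
      using y by (simp add: I_def[of x] abs_divide divide_le_eq mult_ac)
  qed
  have "((\<lambda>y. (I y - I x) / (y - x)) \<longlongrightarrow> 0) (at_right x)"
  proof (rule Lim_null_comparison)
    show "\<forall>\<^sub>F y in at_right x. norm ((I y - I x) / (y - x)) \<le> C * ((y - x) powr (1 - \<alpha>) / (1 - \<alpha>))"
      unfolding eventually_at_right[OF assms(1)] using I_bound assms(1) by auto
    have "((\<lambda>y. y - x) \<longlongrightarrow> x - x) (at_right x)"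
      by (intro tendsto_intros)
    then have "((\<lambda>y. (y - x) powr (1 - \<alpha>)) \<longlongrightarrow> 0) (at_right x)"
      using assms(2) by (intro tendsto_zero_powrI[of _ _ _ "1 - \<alpha>"]) (auto simp: eventually_at_filter)
    then show "((\<lambda>y. C * ((y - x) powr (1 - \<alpha>) / (1 - \<alpha>))) \<longlongrightarrow> 0) (at_right x)"
      by (intro tendsto_mult_right_zero tendsto_divide_zero)
  qed
  then show ?thesis
    by (simp add: has_field_derivative_iff I_def)
qed

lemma powr_ek_int_split:
  assumes x: "0 < x" "x \<le> y" and \<alpha>: "0 < \<alpha>" "\<alpha> < 1" and cont: "continuous_on {0..y} f"
  defines "F \<equiv> \<lambda>s. f s - f x"
  shows "y powr (1 - \<alpha>) * ek_int (1 - \<alpha>) 1 f y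
    = (integral {0..x} (\<lambda>s. (y - s) powr (- \<alpha>) * F s) + integral {x..y} (\<lambda>s. (y - s) powr (- \<alpha>) * F s))
        / Gamma (1 - \<alpha>) + f x * gamma_ratio (1 - \<alpha>) 1 * y powr (1 - \<alpha>)"
proof -
  have y: "0 < y"
    using x by simp
  have cont_F: "continuous_on {0..y} F"
    unfolding F_def by (intro continuous_intros cont)
  have has_int: "((\<lambda>s. (y - s) powr (- \<alpha>) * F s) has_integral
      Gamma (1 - \<alpha>) * (y powr (1 - \<alpha>) * ek_int (1 - \<alpha>) 1 F y)) {0..y}"
    using has_integral_rl_kernel[OF y, of "1 - \<alpha>" 1 F F] \<alpha> cont_F by simp
  then have "integral {0..x} (\<lambda>s. (y - s) powr (- \<alpha>) * F s) + integral {x..y} (\<lambda>s. (y - s) powr (- \<alpha>) * F s)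
      = integral {0..y} (\<lambda>s. (y - s) powr (- \<alpha>) * F s)"
    using x by (intro Henstock_Kurzweil_Integration.integral_combine) auto
  moreover have "Gamma (1 - \<alpha>) \<noteq> 0"
    using less_imp_neq[OF Gamma_real_pos, of "1 - \<alpha>"] \<alpha> by simp
  ultimately have "(integral {0..x} (\<lambda>s. (y - s) powr (- \<alpha>) * F s)
      + integral {x..y} (\<lambda>s. (y - s) powr (- \<alpha>) * F s))
      / Gamma (1 - \<alpha>) = y powr (1 - \<alpha>) * ek_int (1 - \<alpha>) 1 F y"
    by (simp add: integral_unique[OF has_int])
  moreover have "ek_int (1 - \<alpha>) 1 F y = ek_int (1 - \<alpha>) 1 f y - f x * gamma_ratio (1 - \<alpha>) 1"
    unfolding F_def using \<alpha> y
    by (subst ek_int_diff) (auto simp: ek_int_const intro!: ek_integrable_continuous[of _ _ y] cont)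
  ultimately show ?thesis
    by (simp add: right_diff_distrib)
qed

lemma marchaud_deriv_eq:
  assumes "\<alpha> < 1"
  shows "marchaud_deriv \<alpha> f x
    = integral {0..x} (\<lambda>s. - \<alpha> * (x - s) powr (- \<alpha> - 1) * (f s - f x)) / Gamma (1 - \<alpha>)
        + f x * gamma_ratio (1 - \<alpha>) 1 * ((1 - \<alpha>) * x powr (- \<alpha>))"
proof -
  define m where "m s = (x - s) powr (- \<alpha> - 1) * (f x - f s)" for s
  have "(\<lambda>s. - \<alpha> * (x - s) powr (- \<alpha> - 1) * (f s - f x)) = (\<lambda>s. \<alpha> * m s)"
    by (auto simp: m_def algebra_simps)
  moreover have "f x * gamma_ratio (1 - \<alpha>) 1 * (1 - \<alpha>) = f x / Gamma (1 - \<alpha>)"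
    using Gamma_real_plus1[of "1 - \<alpha>"] assms by (simp add: gamma_ratio_def add.commute)
  then have "f x * gamma_ratio (1 - \<alpha>) 1 * ((1 - \<alpha>) * x powr (- \<alpha>)) = f x / Gamma (1 - \<alpha>) * x powr (- \<alpha>)"
    by (simp only: mult.assoc[symmetric])
  ultimately show ?thesis
    by (simp add: marchaud_deriv_def m_def[abs_def] add_divide_distrib)
qed

lemma powr_ek_int_has_right_derivative:
  assumes x: "x \<in> {0<..<B}" and \<alpha>: "0 < \<alpha>" "\<alpha> < 1" and cont: "continuous_on {0..B} f"
    and lip: "\<And>y. y \<in> {0..B} \<Longrightarrow> \<bar>f y - f x\<bar> \<le> C * \<bar>y - x\<bar>"
  shows "((\<lambda>y. y powr (1 - \<alpha>) * ek_int (1 - \<alpha>) 1 f y) has_real_derivative marchaud_deriv \<alpha> f x) (at_right x)"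
proof -
  define F where "F s = f s - f x" for s
  define I where "I u v y = integral {u..v} (\<lambda>s. (y - s) powr (- \<alpha>) * F s)" for u v y
  define c where "c = f x * gamma_ratio (1 - \<alpha>) 1"
  have cont_F: "continuous_on {0..B} F"
    unfolding F_def by (intro continuous_intros cont)
  have lower: "(I 0 x has_real_derivative
      integral {0..x} (\<lambda>s. - \<alpha> * (x - s) powr (- \<alpha> - 1) * F s)) (at_right x)"
    unfolding I_def
  proof (rule has_right_derivative_kernel_integral[OF _ \<alpha>])
    show "\<bar>F s\<bar> \<le> C * (x - s)" if "s \<in> {0..x}" for s
      using lip[of s] that x by (simp add: F_def)
  qed (use x in \<open>auto intro: continuous_on_subset[OF cont_F]\<close>)
  have upper: "((\<lambda>y. I x y y) has_real_derivative 0) (at_right x)"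
    unfolding I_def
  proof (rule has_right_derivative_kernel_integral_upper[OF _ \<alpha>(2)])
    show "\<bar>F s\<bar> \<le> C * (s - x)" if "s \<in> {x..B}" for s
      using lip[of s] that x by (simp add: F_def)
  qed (use x in \<open>auto intro: continuous_on_subset[OF cont_F]\<close>)
  have power: "((\<lambda>y. y powr (1 - \<alpha>)) has_real_derivative (1 - \<alpha>) * x powr (- \<alpha>)) (at_right x)"
    using x by (auto intro!: derivative_eq_intros)
  have deriv: "((\<lambda>y. (I 0 x y + I x y y) / Gamma (1 - \<alpha>) + c * y powr (1 - \<alpha>)) has_real_derivative
      marchaud_deriv \<alpha> f x) (at_right x)"
    using DERIV_add[OF DERIV_cdivide[OF DERIV_add[OF lower upper]] DERIV_cmult[OF power]]
    unfolding marchaud_deriv_eq[OF \<alpha>(2)] F_def[symmetric] c_def[symmetric] add_0_right .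
  have eq: "(I 0 x y + I x y y) / Gamma (1 - \<alpha>) + c * y powr (1 - \<alpha>)
      = y powr (1 - \<alpha>) * ek_int (1 - \<alpha>) 1 f y" if "y \<in> {x..B}" for y
    using powr_ek_int_split[of x y \<alpha> f] that x \<alpha> continuous_on_subset[OF cont, of "{0..y}"]
    by (simp add: I_def F_def c_def)
  have "\<forall>\<^sub>F y in at_right x. (I 0 x y + I x y y) / Gamma (1 - \<alpha>) + c * y powr (1 - \<alpha>)
      = y powr (1 - \<alpha>) * ek_int (1 - \<alpha>) 1 f y"
    using x eq by (auto simp: eventually_at_right[of x B] intro!: exI[of _ B])
  from has_field_derivative_cong_eventually[OF this eq] deriv show ?thesis
    using x by simp
qed

lemma continuous_on_powr_kernel_mult:
  fixes f :: "real \<Rightarrow> real"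
  assumes "\<alpha> < 1" and cont: "continuous_on {a..x} f"
    and bound: "\<And>s. s \<in> {a..x} \<Longrightarrow> \<bar>f s\<bar> \<le> C * (x - s)"
  shows "continuous_on {a..x} (\<lambda>y. (x - y) powr (- \<alpha>) * f y)"
  unfolding continuous_on_def
proof
  fix y assume y: "y \<in> {a..x}"
  show "((\<lambda>y. (x - y) powr (- \<alpha>) * f y) \<longlongrightarrow> (x - y) powr (- \<alpha>) * f y) (at y within {a..x})"
  proof (cases "y = x")
    case False
    then show ?thesis
      using cont y by (intro tendsto_intros) (auto simp: continuous_on_def)
  next
    case True
    have "((\<lambda>z. x - z) \<longlongrightarrow> x - x) (at x within {a..x})"
      by (intro tendsto_intros)
    then have "((\<lambda>z. (x - z) powr (1 - \<alpha>)) \<longlongrightarrow> 0) (at x within {a..x})"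
      using assms(1) by (intro tendsto_zero_powrI[of _ _ _ "1 - \<alpha>"]) (auto simp: eventually_at_filter)
    then have "((\<lambda>z. C * (x - z) powr (1 - \<alpha>)) \<longlongrightarrow> 0) (at x within {a..x})"
      by (rule tendsto_mult_right_zero)
    moreover have "norm ((x - z) powr (- \<alpha>) * f z) \<le> C * (x - z) powr (1 - \<alpha>)"
      if "z \<noteq> x" "z \<in> {a..x}" for z
    proof -
      have "norm ((x - z) powr (- \<alpha>) * f z) \<le> (x - z) powr (- \<alpha>) * (C * (x - z))"
        using bound[OF that(2)] by (simp add: abs_mult mult_left_mono)
      also have "\<dots> = C * (x - z) powr (1 - \<alpha>)"
        using that by (simp add: powr_diff powr_minus divide_inverse)
      finally show ?thesis .
    qed
    then have "\<forall>\<^sub>F z in at x within {a..x}. norm ((x - z) powr (- \<alpha>) * f z) \<le> C * (x - z) powr (1 - \<alpha>)"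
      by (auto simp: eventually_at_filter)
    ultimately have "((\<lambda>z. (x - z) powr (- \<alpha>) * f z) \<longlongrightarrow> 0) (at x within {a..x})"
      by (rule Lim_null_comparison[rotated])
    then show ?thesis
      using True by simp
  qed
qed

text \<open>Integration by parts: an antiderivative of \<open>(x - y) powr (- \<alpha>) * f' y\<close> which is continuous up to \<open>x\<close>
  if \<open>f\<close> is Lipschitz at \<open>x\<close>.\<close>

definition marchaud_primitive :: "real \<Rightarrow> (real \<Rightarrow> real) \<Rightarrow> real \<Rightarrow> real \<Rightarrow> real" where
  "marchaud_primitive \<alpha> f x y =
     \<alpha> * integral {0..y} (\<lambda>s. (x - s) powr (- \<alpha> - 1) * (f x - f s)) - (x - y) powr (- \<alpha>) * (f x - f y)"

lemma marchaud_primitive_diff: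
  assumes "\<alpha> < 1"
  shows "marchaud_primitive \<alpha> f x x - marchaud_primitive \<alpha> f x 0
    = Gamma (1 - \<alpha>) * marchaud_deriv \<alpha> (\<lambda>s. f s - f 0) x"
proof -
  have "0 < Gamma (1 - \<alpha>)"
    using assms by (intro Gamma_real_pos) auto
  then show ?thesis
    by (simp add: marchaud_primitive_def marchaud_deriv_def)
qed

lemma continuous_on_marchaud_primitive:
  assumes "0 < x" "\<alpha> < 1" and cont: "continuous_on {0..x} f"
    and lip: "\<And>s. s \<in> {0..x} \<Longrightarrow> \<bar>f s - f x\<bar> \<le> C * \<bar>s - x\<bar>"
  shows "continuous_on {0..x} (marchaud_primitive \<alpha> f x)"
proof -
  have bound: "\<bar>f x - f s\<bar> \<le> C * (x - s)" if "s \<in> {0..x}" for s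
    using lip[OF that] that by (simp add: abs_minus_commute)
  have cont': "continuous_on {0..x} (\<lambda>s. f x - f s)"
    by (intro continuous_intros cont)
  have "(\<lambda>s. (x - s) powr (- \<alpha> - 1) * (f x - f s)) integrable_on {0..x}"
    using assms by (intro marchaud_kernel_integrable[OF _ _ cont' bound]) auto
  then show ?thesis
    unfolding marchaud_primitive_def
    by (intro continuous_intros indefinite_integral_continuous_1
        continuous_on_powr_kernel_mult[OF assms(2) cont' bound])
qed

lemma marchaud_primitive_has_derivative:
  assumes "\<alpha> < 1" and cont: "continuous_on {0..x} f"
    and lip: "\<And>s. s \<in> {0..x} \<Longrightarrow> \<bar>f s - f x\<bar> \<le> C * \<bar>s - x\<bar>"
    and y: "y \<in> {0<..<x}" and deriv: "(f has_real_derivative d) (at y)"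
  shows "(marchaud_primitive \<alpha> f x has_real_derivative (x - y) powr (- \<alpha>) * d) (at y)"
proof -
  define m where "m s = (x - s) powr (- \<alpha> - 1) * (f x - f s)" for s
  have "m integrable_on {0..x}"
    unfolding m_def
  proof (rule marchaud_kernel_integrable[where C = C])
    show "\<bar>f x - f s\<bar> \<le> C * (x - s)" if "s \<in> {0..x}" for s
      using lip[OF that] that by (simp add: abs_minus_commute)
  qed (use assms(1) y in \<open>auto intro!: continuous_intros cont\<close>)
  moreover have "isCont m y"
    unfolding m_def using y DERIV_isCont[OF deriv] by (intro continuous_intros) auto
  ultimately have "((\<lambda>y. integral {0..y} m) has_real_derivative m y) (at y)"
    using y by (intro integral_has_real_derivative_at) auto
  then have "(marchaud_primitive \<alpha> f x has_real_derivative
      \<alpha> * m y - (\<alpha> * (x - y) powr (- \<alpha> - 1) * (f x - f y) + (- d) * (x - y) powr (- \<alpha>))) (at y)"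
    unfolding marchaud_primitive_def[abs_def] m_def using y deriv
    by (intro DERIV_diff DERIV_cmult DERIV_mult) (auto intro!: derivative_eq_intros)
  then show ?thesis
    by (simp add: m_def algebra_simps)
qed

context psi_scale
begin

lemma has_integral_marchaud_deriv:
  assumes t: "t \<in> {a<..b}" and \<alpha>: "0 < \<alpha>" "\<alpha> < 1" and cont: "continuous_on {0..X b} \<Phi>"
    and deriv: "\<And>s. s \<in> {a<..<t} \<Longrightarrow> ((\<lambda>s. \<Phi> (X s)) has_real_derivative d s) (at s)"
    and lip: "\<And>y. y \<in> {0..X b} \<Longrightarrow> \<bar>\<Phi> y - \<Phi> (X t)\<bar> \<le> C * \<bar>y - X t\<bar>"
  shows "((\<lambda>s. (X t - X s) powr (- \<alpha>) * d s) has_integral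
    Gamma (1 - \<alpha>) * marchaud_deriv \<alpha> (\<lambda>s. \<Phi> s - \<Phi> 0) (X t)) {a..t}"
proof -
  define G where "G = marchaud_primitive \<alpha> \<Phi> (X t)"
  have Xt: "0 < X t" "{0..X t} \<subseteq> {0..X b}"
    using X_mem[OF t] by auto
  have lip_t: "\<bar>\<Phi> y - \<Phi> (X t)\<bar> \<le> C * \<bar>y - X t\<bar>" if "y \<in> {0..X t}" for y
    using lip that Xt(2) by blast
  note cont_t = continuous_on_subset[OF cont Xt(2)]
  have "((\<lambda>s. (X t - X s) powr (- \<alpha>) * d s) has_integral G (X t) - G (X a)) {a..t}"
  proof (rule fundamental_theorem_of_calculus_interior)
    show "continuous_on {a..t} (\<lambda>s. G (X s))"
    proof (rule continuous_on_compose2[of "{0..X t}" G "{a..t}" X])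
      show "continuous_on {0..X t} G"
        unfolding G_def by (rule continuous_on_marchaud_primitive[OF Xt(1) \<alpha>(2) cont_t lip_t])
      show "continuous_on {a..t} X"
        using t by (intro continuous_on_subset[OF continuous_on_X]) auto
    qed (use X_image[of t] t in auto)
    fix s assume s: "s \<in> {a<..<t}"
    then have s_mem: "s \<in> {a<..<b}" and Xs: "X s \<in> {0<..<X t}"
      using t X_pos[of s] X_less[of s t] by auto
    have "(G has_real_derivative (X t - X s) powr (- \<alpha>) * (d s / \<Psi>' s)) (at (X s))"
      unfolding G_def
      by (rule marchaud_primitive_has_derivative[OF \<alpha>(2) cont_t lip_t Xs
            has_real_derivative_in_X[OF s_mem deriv[OF s]]])
    from DERIV_chain2[OF this X_deriv_at[OF s_mem]]
    show "((\<lambda>s. G (X s)) has_vector_derivative (X t - X s) powr (- \<alpha>) * d s) (at s)"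
      using deriv_pos[of s] s_mem by (simp add: has_real_derivative_iff_has_vector_derivative)
  qed (use t in simp)
  then show ?thesis
    using marchaud_primitive_diff[OF \<alpha>(2), of \<Phi> "X t"] by (simp add: G_def)
qed

end


section \<open>From the differential to the integral equation\<close>

lemma powr_ek_int_linear_has_derivative:
  assumes "0 < \<mu>" "0 < x"
  shows "((\<lambda>x. x powr \<mu> * ek_int \<mu> 1 (\<lambda>s. C * s) x) has_real_derivative C * x powr \<mu> / Gamma (\<mu> + 1)) (at x)"
proof (rule has_field_derivative_transform_within_open)
  have "((\<lambda>y. C * gamma_ratio \<mu> 2 * y powr (\<mu> + 1)) has_real_derivative
      C * gamma_ratio \<mu> 2 * ((\<mu> + 1) * x powr \<mu>)) (at x)"
    using assms by (auto intro!: derivative_eq_intros)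
  moreover have "C * gamma_ratio \<mu> 2 * ((\<mu> + 1) * x powr \<mu>) = C * x powr \<mu> / Gamma (\<mu> + 1)"
    using Gamma_real_plus1[of "\<mu> + 1"] \<open>0 < \<mu>\<close> by (simp add: gamma_ratio_def Gamma_numeral add.commute)
  ultimately show "((\<lambda>y. C * gamma_ratio \<mu> 2 * y powr (\<mu> + 1)) has_real_derivative
      C * x powr \<mu> / Gamma (\<mu> + 1)) (at x)"
    by simp
  show "C * gamma_ratio \<mu> 2 * y powr (\<mu> + 1) = y powr \<mu> * ek_int \<mu> 1 (\<lambda>s. C * s) y" if "y \<in> {0<..}" for y
    using ek_int_power[of \<mu> 1 1 y] that \<open>0 < \<mu>\<close> by (simp add: ek_int_cmult[of _ _ C] powr_add)
qed (use \<open>0 < x\<close> in auto)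

lemma powr_ek_int_deriv_bound:
  assumes "0 < \<mu>" and lip: "C-lipschitz_on {0..B} D" and "D 0 = 0" and x: "x \<in> {0<..<B}"
    and deriv: "((\<lambda>x. x powr \<mu> * ek_int \<mu> 1 D x) has_real_derivative w) (at x)"
  shows "\<bar>w\<bar> \<le> C * x powr \<mu> / Gamma (\<mu> + 1)"
proof -
  define W where "W x = x powr \<mu> * ek_int \<mu> 1 D x" for x
  define N where "N x = x powr \<mu> * ek_int \<mu> 1 (\<lambda>s. C * s) x" for x
  define n where "n = C * x powr \<mu> / Gamma (\<mu> + 1)"
  have cont_D: "continuous_on {0..B} D"
    using lipschitz_on_continuous_on[OF lip] .
  note integrable = ek_integrable_continuous[of \<mu> 1 B]
  have deriv_N: "(N has_real_derivative n) (at x)"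
    unfolding N_def[abs_def] n_def using powr_ek_int_linear_has_derivative[OF \<open>0 < \<mu>\<close>] x by simp
  have deriv_W: "(W has_real_derivative w) (at x)"
    using deriv by (simp add: W_def[abs_def])
  have mono_N: "mono_on {0..B} (\<lambda>y. y powr \<mu> * ek_int \<mu> 1 (\<lambda>s. C * s + D s) y)"
    "mono_on {0..B} (\<lambda>y. y powr \<mu> * ek_int \<mu> 1 (\<lambda>s. C * s - D s) y)"
    using lip lipschitz_on_nonneg[OF lip] \<open>0 < \<mu>\<close> \<open>D 0 = 0\<close> cont_D
    by (auto simp: lipschitz_on_iff_mono_on intro!: mono_on_powr_ek_int continuous_intros)
  have "mono_on {0..B} (\<lambda>y. N y + W y)"
    using mono_N(1) cont_D \<open>0 < \<mu>\<close>
    by (auto simp: mono_on_def N_def W_def ek_int_add integrable continuous_intros distrib_left)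
  from mono_on_imp_deriv_nonneg[OF this DERIV_add[OF deriv_N deriv_W]] have "0 \<le> n + w"
    using x by simp
  moreover have "mono_on {0..B} (\<lambda>y. N y - W y)"
    using mono_N(2) cont_D \<open>0 < \<mu>\<close>
    by (auto simp: mono_on_def N_def W_def ek_int_diff integrable continuous_intros right_diff_distrib)
  from mono_on_imp_deriv_nonneg[OF this DERIV_diff[OF deriv_N deriv_W]] have "0 \<le> n - w"
    using x by simp
  ultimately show ?thesis
    by (simp add: n_def abs_le_iff)
qed

definition hilfer_primitive :: "real \<Rightarrow> real \<Rightarrow> (real \<Rightarrow> real) \<Rightarrow> real \<Rightarrow> real" where
  "hilfer_primitive \<mu> \<rho> g x =
     x powr (\<rho> - \<mu>) * ek_int (\<rho> - \<mu>) 1 (\<lambda>s. ek_int (1 - \<rho>) \<rho> g s - ek_int (1 - \<rho>) \<rho> g 0) x"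

definition differential_defect :: "real \<Rightarrow> real \<Rightarrow> (real \<Rightarrow> real) \<Rightarrow> (real \<Rightarrow> real) \<Rightarrow> real \<Rightarrow> real" where
  "differential_defect \<mu> \<rho> g f x = hilfer_primitive \<mu> \<rho> g x - x powr \<rho> * ek_int 1 \<rho> f x"

definition integral_defect :: "real \<Rightarrow> real \<Rightarrow> (real \<Rightarrow> real) \<Rightarrow> (real \<Rightarrow> real) \<Rightarrow> real \<Rightarrow> real" where
  "integral_defect \<mu> \<rho> g f x = g x - g 0 - x powr \<mu> * ek_int \<mu> \<rho> f x"

lemma continuous_on_powr_ek_int_vanishing:
  assumes "0 \<le> q" "0 \<le> \<alpha>" "0 < p" "continuous_on {0..B} g" "g 0 = 0"
  shows "continuous_on {0..B} (\<lambda>x. x powr q * ek_int \<alpha> p g x)"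
proof (cases "q = 0")
  case True
  show ?thesis
  proof (rule continuous_on_eq[OF continuous_on_ek_int[OF assms(2-4)]])
    show "ek_int \<alpha> p g x = x powr q * ek_int \<alpha> p g x" for x
      using ek_int_at_0[of \<alpha> p g] assms True by (cases "x = 0") auto
  qed
next
  case False
  then show ?thesis
    using assms by (intro continuous_on_powr_ek_int) auto
qed

context
  fixes \<mu> \<rho> B :: real
  assumes orders: "0 < \<mu>" "\<mu> \<le> \<rho>" "\<rho> \<le> 1"
begin

lemma continuous_on_hilfer_primitive:
  assumes "continuous_on {0..B} g"
  shows "continuous_on {0..B} (hilfer_primitive \<mu> \<rho> g)"
  unfolding hilfer_primitive_def[abs_def] using orders assms
  by (intro continuous_on_powr_ek_int_vanishing continuous_intros continuous_on_ek_int) auto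

lemma continuous_on_differential_defect:
  assumes "continuous_on {0..B} g" "continuous_on {0..B} f"
  shows "continuous_on {0..B} (differential_defect \<mu> \<rho> g f)"
  unfolding differential_defect_def[abs_def] using orders assms
  by (intro continuous_on_diff continuous_on_hilfer_primitive continuous_on_powr_ek_int) auto

lemma continuous_on_integral_defect:
  assumes "continuous_on {0..B} g" "continuous_on {0..B} f"
  shows "continuous_on {0..B} (integral_defect \<mu> \<rho> g f)"
  unfolding integral_defect_def[abs_def] using orders assms
  by (intro continuous_on_diff continuous_on_const continuous_on_powr_ek_int) auto

lemma ek_int_hilfer_primitive:
  assumes g: "continuous_on {0..B} g" and x: "x \<in> {0..B}"
  shows "ek_int \<mu> 1 (hilfer_primitive \<mu> \<rho> g) x = x powr (\<rho> - \<mu>) * ek_int 1 \<rho> (\<lambda>s. g s - g 0) x"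
proof -
  define \<Phi> where "\<Phi> = ek_int (1 - \<rho>) \<rho> g"
  have \<Phi>: "continuous_on {0..B} \<Phi>" and \<Phi>_0: "\<Phi> 0 = g 0 * gamma_ratio (1 - \<rho>) \<rho>"
    unfolding \<Phi>_def using orders g by (auto intro: continuous_on_ek_int ek_int_at_0)
  note integrable = ek_integrable_continuous[of _ _ B, OF _ _ _ x]
  have "ek_int \<mu> 1 (hilfer_primitive \<mu> \<rho> g) x
      = x powr (\<rho> - \<mu>) * ek_int \<mu> (1 + (\<rho> - \<mu>)) (ek_int (\<rho> - \<mu>) 1 (\<lambda>s. \<Phi> s - \<Phi> 0)) x"
    unfolding hilfer_primitive_def[abs_def] \<Phi>_def using x by (intro ek_int_powr_mult) auto
  also have "ek_int \<mu> (1 + (\<rho> - \<mu>)) (ek_int (\<rho> - \<mu>) 1 (\<lambda>s. \<Phi> s - \<Phi> 0)) x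
      = ek_int \<rho> 1 (\<lambda>s. \<Phi> s - \<Phi> 0) x"
    using ek_int_semigroup[of "\<rho> - \<mu>" \<mu> 1 B _ x] orders x \<Phi> by (simp add: continuous_on_diff)
  also have "\<dots> = ek_int \<rho> 1 \<Phi> x - \<Phi> 0 * gamma_ratio \<rho> 1"
    using orders \<Phi> by (simp add: ek_int_diff integrable ek_int_const)
  also have "ek_int \<rho> 1 \<Phi> x = ek_int 1 \<rho> g x"
    using ek_int_semigroup[of "1 - \<rho>" \<rho> \<rho> B g x] orders x g by (simp add: \<Phi>_def)
  also have "\<Phi> 0 * gamma_ratio \<rho> 1 = g 0 * gamma_ratio 1 \<rho>"
    using gamma_ratio_mult[of "1 - \<rho>" \<rho> \<rho>] orders by (simp add: \<Phi>_0)
  also have "ek_int 1 \<rho> g x - g 0 * gamma_ratio 1 \<rho> = ek_int 1 \<rho> (\<lambda>s. g s - g 0) x"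
    using orders g by (simp add: ek_int_diff integrable ek_int_const)
  finally show ?thesis .
qed

lemma powr_ek_int_differential_defect:
  assumes g: "continuous_on {0..B} g" and f: "continuous_on {0..B} f" and x: "x \<in> {0..B}"
  shows "x powr \<mu> * ek_int \<mu> 1 (differential_defect \<mu> \<rho> g f) x
    = x powr \<rho> * ek_int 1 \<rho> (integral_defect \<mu> \<rho> g f) x"
proof -
  note integrable = ek_integrable_continuous[of _ _ B, OF _ _ _ x]
  have cont_I: "continuous_on {0..B} (\<lambda>s. s powr q * ek_int q \<rho> f s)" if "0 < q" for q
    using orders f that by (intro continuous_on_powr_ek_int) auto
  have order_1: "ek_int \<mu> 1 (\<lambda>s. s powr \<rho> * ek_int 1 \<rho> f s) x = x powr \<rho> * ek_int (1 + \<mu>) \<rho> f x"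
    using ek_int_semigroup[of 1 \<mu> \<rho> B f x] orders f x by (simp add: ek_int_powr_mult add.commute)
  have order_\<mu>: "ek_int 1 \<rho> (\<lambda>s. s powr \<mu> * ek_int \<mu> \<rho> f s) x = x powr \<mu> * ek_int (1 + \<mu>) \<rho> f x"
    using ek_int_semigroup[of \<mu> 1 \<rho> B f x] orders f x by (simp add: ek_int_powr_mult add.commute)
  have differential: "ek_int \<mu> 1 (differential_defect \<mu> \<rho> g f) x
      = ek_int \<mu> 1 (hilfer_primitive \<mu> \<rho> g) x - ek_int \<mu> 1 (\<lambda>s. s powr \<rho> * ek_int 1 \<rho> f s) x"
    unfolding differential_defect_def[abs_def] using orders cont_I[of 1] g f
    by (intro ek_int_diff integrable continuous_on_hilfer_primitive continuous_on_powr_ek_int) auto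
  have integral: "ek_int 1 \<rho> (integral_defect \<mu> \<rho> g f) x
      = ek_int 1 \<rho> (\<lambda>s. g s - g 0) x - ek_int 1 \<rho> (\<lambda>s. s powr \<mu> * ek_int \<mu> \<rho> f s) x"
    unfolding integral_defect_def[abs_def] using orders cont_I[of \<mu>] g
    by (intro ek_int_diff integrable continuous_on_diff continuous_on_const) auto
  have powr_\<rho>: "x powr \<rho> = x powr \<mu> * x powr (\<rho> - \<mu>)"
    by (simp flip: powr_add)
  show ?thesis
    unfolding differential integral order_1 order_\<mu> ek_int_hilfer_primitive[OF g x] powr_\<rho>
    by (simp add: algebra_simps)
qed

lemma integral_defect_bound:
  assumes g: "continuous_on {0..B} g" and f: "continuous_on {0..B} f" and "0 < B"
    and lip: "C-lipschitz_on {0..B} (differential_defect \<mu> \<rho> g f)" and x: "x \<in> {0..B}"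
  shows "\<bar>integral_defect \<mu> \<rho> g f x\<bar> \<le> C / Gamma (\<mu> + 1) * x powr (\<mu> + 1 - \<rho>)"
proof -
  define v where "v = integral_defect \<mu> \<rho> g f"
  have cont_v: "continuous_on {0..B} v"
    unfolding v_def using g f by (rule continuous_on_integral_defect)
  have interior: "\<bar>v x\<bar> \<le> C / Gamma (\<mu> + 1) * x powr (\<mu> + 1 - \<rho>)" if x: "x \<in> {0<..<B}" for x
  proof -
    have "((\<lambda>x. x powr \<rho> * ek_int 1 \<rho> v x) has_real_derivative x powr (\<rho> - 1) * v x) (at x)"
      using orders cont_v x by (intro ek_int_1_has_derivative) auto
    then have "((\<lambda>x. x powr \<mu> * ek_int \<mu> 1 (differential_defect \<mu> \<rho> g f) x) has_real_derivative
        x powr (\<rho> - 1) * v x) (at x)"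
      by (rule has_field_derivative_transform_within_open[where S = "{0<..<B}"])
        (use x powr_ek_int_differential_defect[OF g f] in \<open>auto simp: v_def\<close>)
    then have "\<bar>x powr (\<rho> - 1) * v x\<bar> \<le> C * x powr \<mu> / Gamma (\<mu> + 1)"
      using orders x by (intro powr_ek_int_deriv_bound[OF _ lip])
        (auto simp: differential_defect_def hilfer_primitive_def)
    then have "x powr (1 - \<rho>) * \<bar>x powr (\<rho> - 1) * v x\<bar> \<le> x powr (1 - \<rho>) * (C * x powr \<mu> / Gamma (\<mu> + 1))"
      by (intro mult_left_mono) auto
    moreover have "x powr (1 - \<rho>) * \<bar>x powr (\<rho> - 1) * v x\<bar> = \<bar>v x\<bar>"
      using x by (simp add: abs_mult flip: powr_add mult.assoc)
    moreover have "x powr (\<mu> + 1 - \<rho>) = x powr (1 - \<rho>) * x powr \<mu>"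
      by (simp add: algebra_simps flip: powr_add)
    ultimately show ?thesis
      by (simp add: mult_ac)
  qed
  define u where "u x = C / Gamma (\<mu> + 1) * x powr (\<mu> + 1 - \<rho>) - \<bar>v x\<bar>" for x
  have "continuous_on {0..B} u"
    unfolding u_def using orders by (intro continuous_intros continuous_on_powr_nonneg cont_v) auto
  then have "continuous_on (closure {0<..<B}) u" "x \<in> closure {0<..<B}"
    using \<open>0 < B\<close> x by auto
  then have "0 \<le> u x"
    by (rule continuous_ge_on_closure) (use interior in \<open>simp add: u_def\<close>)
  then show ?thesis
    by (simp add: u_def v_def)
qed

end

locale hilfer_setting = psi_scale +
  fixes \<mu> \<nu> \<rho> :: real
  assumes \<mu>: "0 < \<mu>" "\<mu> < 1" and \<nu>: "0 \<le> \<nu>" "\<nu> \<le> 1" and \<rho>: "\<rho> = \<mu> + \<nu> - \<mu> * \<nu>"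
begin

lemma orders_eq: "\<nu> * (1 - \<mu>) = \<rho> - \<mu>" "(1 - \<nu>) * (1 - \<mu>) = 1 - \<rho>"
  unfolding \<rho> by (auto simp: algebra_simps)

lemma orders_bounds: "\<mu> \<le> \<rho>" "\<rho> \<le> 1" "0 < \<rho>" "\<rho> - \<mu> < 1"
proof -
  have "0 \<le> \<nu> * (1 - \<mu>)" "0 \<le> (1 - \<nu>) * (1 - \<mu>)"
    using \<mu> \<nu> by auto
  then show "\<mu> \<le> \<rho>" "\<rho> \<le> 1" "0 < \<rho>" "\<rho> - \<mu> < 1"
    unfolding orders_eq using \<mu> by auto
qed

context
  fixes y g :: "real \<Rightarrow> real"
  assumes y: "profile \<rho> y g" and y_ex: "hilfer_exists \<mu> \<nu> \<Psi> \<Psi>' a b y"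
begin

lemma continuous_on_ek_int_profile: "continuous_on {0..X b} (ek_int (1 - \<rho>) \<rho> g)"
  using orders_bounds profile_continuous[OF y] by (intro continuous_on_ek_int) auto

lemma ek_int_profile_has_derivative:
  assumes t: "t \<in> {a<..<b}"
  shows "((\<lambda>s. ek_int (1 - \<rho>) \<rho> g (X s)) has_real_derivative
    vector_derivative (frac_int (1 - \<rho>) \<Psi> \<Psi>' a y) (at t within {a..b})) (at t)"
proof (rule has_field_derivative_transform_within_open)
  have "frac_int (1 - \<rho>) \<Psi> \<Psi>' a y differentiable (at t within {a..b})"
    using y_ex t unfolding hilfer_exists_def orders_eq by auto
  then show "(frac_int (1 - \<rho>) \<Psi> \<Psi>' a y has_real_derivative
      vector_derivative (frac_int (1 - \<rho>) \<Psi> \<Psi>' a y) (at t within {a..b})) (at t)"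
    using at_within_Icc_at[of a t b] t
    by (simp add: vector_derivative_works has_real_derivative_iff_has_vector_derivative)
  show "frac_int (1 - \<rho>) \<Psi> \<Psi>' a y s = ek_int (1 - \<rho>) \<rho> g (X s)" if "s \<in> {a<..<b}" for s
    using frac_int_profile[OF y, of "1 - \<rho>" s] orders_bounds X_pos[of s] that by simp
qed (use t in auto)

lemma ek_int_profile_lipschitz_at:
  assumes t: "t \<in> {a<..<b}"
  obtains C where "\<And>x. x \<in> {0..X b} \<Longrightarrow>
    \<bar>ek_int (1 - \<rho>) \<rho> g x - ek_int (1 - \<rho>) \<rho> g (X t)\<bar> \<le> C * \<bar>x - X t\<bar>"
  by (rule lipschitz_at_of_has_real_derivative[OF _ continuous_on_ek_int_profile
        has_field_derivative_at_within[OF has_real_derivative_in_X[OF t ek_int_profile_has_derivative[OF t]]]])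
    (use that in auto)

lemma hilfer_eq_marchaud_deriv:
  assumes t: "t \<in> {a<..<b}" and "\<mu> < \<rho>"
  defines "\<Phi> \<equiv> ek_int (1 - \<rho>) \<rho> g"
  shows "hilfer \<mu> \<nu> \<Psi> \<Psi>' a b y t = marchaud_deriv (1 - (\<rho> - \<mu>)) (\<lambda>s. \<Phi> s - \<Phi> 0) (X t)"
proof -
  define d where "d s = vector_derivative (frac_int (1 - \<rho>) \<Psi> \<Psi>' a y) (at s within {a..b})" for s
  obtain C where C: "\<And>x. x \<in> {0..X b} \<Longrightarrow> \<bar>\<Phi> x - \<Phi> (X t)\<bar> \<le> C * \<bar>x - X t\<bar>"
    unfolding \<Phi>_def using ek_int_profile_lipschitz_at[OF t] by blast
  have deriv: "((\<lambda>s. \<Phi> (X s)) has_real_derivative d s) (at s)" if "s \<in> {a<..<t}" for s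
    unfolding \<Phi>_def d_def using that t by (intro ek_int_profile_has_derivative) auto
  have "((\<lambda>s. (X t - X s) powr (- (1 - (\<rho> - \<mu>))) * d s) has_integral
      Gamma (1 - (1 - (\<rho> - \<mu>))) * marchaud_deriv (1 - (\<rho> - \<mu>)) (\<lambda>s. \<Phi> s - \<Phi> 0) (X t)) {a..t}"
    using t orders_bounds \<open>\<mu> < \<rho>\<close> deriv C continuous_on_ek_int_profile unfolding \<Phi>_def
    by (intro has_integral_marchaud_deriv[where C = C]) auto
  then have "((\<lambda>s. (X t - X s) powr (\<rho> - \<mu> - 1) * d s) has_integral
      Gamma (\<rho> - \<mu>) * marchaud_deriv (1 - (\<rho> - \<mu>)) (\<lambda>s. \<Phi> s - \<Phi> 0) (X t)) {a..t}"
    by simp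
  then have "((\<lambda>s. \<Psi>' s * (\<Psi> t - \<Psi> s) powr (\<rho> - \<mu> - 1) * (1 / \<Psi>' s * d s)) has_integral
      Gamma (\<rho> - \<mu>) * marchaud_deriv (1 - (\<rho> - \<mu>)) (\<lambda>s. \<Phi> s - \<Phi> 0) (X t)) {a..t}"
    by (rule has_integral_eq[rotated]) (use deriv_pos t in \<open>force simp: X_def\<close>)
  then show ?thesis
    using \<open>\<mu> < \<rho>\<close> less_imp_neq[OF Gamma_real_pos, of "\<rho> - \<mu>"]
    by (simp add: hilfer_def orders_eq frac_int_def integral_unique d_def)
qed

lemma hilfer_primitive_has_right_derivative:
  assumes t: "t \<in> {a<..<b}"
  shows "(hilfer_primitive \<mu> \<rho> g has_real_derivative hilfer \<mu> \<nu> \<Psi> \<Psi>' a b y t) (at_right (X t))"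
proof -
  define \<Phi> where "\<Phi> = ek_int (1 - \<rho>) \<rho> g"
  have x: "X t \<in> {0<..<X b}"
    using X_pos[of t] X_less[of t b] t by auto
  show ?thesis
  proof (cases "\<mu> = \<rho>")
    case True
    have "hilfer \<mu> \<nu> \<Psi> \<Psi>' a b y t
        = vector_derivative (frac_int (1 - \<rho>) \<Psi> \<Psi>' a y) (at t within {a..b}) / \<Psi>' t"
      unfolding hilfer_def orders_eq using True by (simp add: frac_int_def[of 0])
    then have "(\<Phi> has_real_derivative hilfer \<mu> \<nu> \<Psi> \<Psi>' a b y t) (at (X t))"
      using has_real_derivative_in_X[OF t ek_int_profile_has_derivative[OF t]] by (simp add: \<Phi>_def)
    then have "((\<lambda>x. \<Phi> x - \<Phi> 0) has_real_derivative hilfer \<mu> \<nu> \<Psi> \<Psi>' a b y t) (at (X t))"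
      by (auto intro!: derivative_eq_intros)
    then have "(hilfer_primitive \<mu> \<rho> g has_real_derivative hilfer \<mu> \<nu> \<Psi> \<Psi>' a b y t) (at (X t))"
      by (rule has_field_derivative_transform_within_open[where S = "{0<..}"])
        (use x True in \<open>auto simp: hilfer_primitive_def ek_int_def \<Phi>_def\<close>)
    then show ?thesis
      by (rule has_field_derivative_at_within)
  next
    case False
    then have "\<mu> < \<rho>"
      using orders_bounds by simp
    obtain C where C: "\<And>x. x \<in> {0..X b} \<Longrightarrow> \<bar>\<Phi> x - \<Phi> (X t)\<bar> \<le> C * \<bar>x - X t\<bar>"
      unfolding \<Phi>_def using ek_int_profile_lipschitz_at[OF t] by blast
    have "((\<lambda>x. x powr (1 - (1 - (\<rho> - \<mu>))) * ek_int (1 - (1 - (\<rho> - \<mu>))) 1 (\<lambda>s. \<Phi> s - \<Phi> 0) x)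
        has_real_derivative marchaud_deriv (1 - (\<rho> - \<mu>)) (\<lambda>s. \<Phi> s - \<Phi> 0) (X t)) (at_right (X t))"
      using x orders_bounds \<open>\<mu> < \<rho>\<close> C continuous_on_ek_int_profile unfolding \<Phi>_def
      by (intro powr_ek_int_has_right_derivative[where C = C]) (auto intro!: continuous_intros)
    then show ?thesis
      unfolding hilfer_eq_marchaud_deriv[OF t \<open>\<mu> < \<rho>\<close>] hilfer_primitive_def[abs_def] \<Phi>_def by simp
  qed
qed

lemma differential_defect_lipschitz:
  assumes h: "profile \<rho> h f" and "0 \<le> \<epsilon>"
    and bound: "\<And>t. t \<in> {a<..b} \<Longrightarrow> \<bar>hilfer \<mu> \<nu> \<Psi> \<Psi>' a b y t - h t\<bar> \<le> \<epsilon>"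
  shows "\<epsilon>-lipschitz_on {0..X b} (differential_defect \<mu> \<rho> g f)"
proof (rule lipschitz_on_Icc_right_deriv_bound[OF \<open>0 \<le> \<epsilon>\<close>])
  show "continuous_on {0..X b} (differential_defect \<mu> \<rho> g f)"
    using \<mu> orders_bounds profile_continuous[OF y] profile_continuous[OF h]
    by (intro continuous_on_differential_defect) auto
  fix x assume x: "x \<in> {0<..<X b}"
  then obtain t where t: "t \<in> {a<..<b}" "x = X t"
    by (rule Ioo_X_cases)
  have "((\<lambda>x. x powr \<rho> * ek_int 1 \<rho> f x) has_real_derivative h t) (at_right x)"
    using ek_int_1_has_derivative[OF orders_bounds(3) profile_continuous[OF h] x] profile_eq[OF h, of t] t
    by (auto intro: has_field_derivative_at_within)
  then have "(differential_defect \<mu> \<rho> g f has_real_derivative hilfer \<mu> \<nu> \<Psi> \<Psi>' a b y t - h t) (at_right x)"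
    unfolding differential_defect_def[abs_def] using hilfer_primitive_has_right_derivative[OF t(1)] t(2)
    by (intro DERIV_diff) auto
  then show "\<exists>d. \<bar>d\<bar> \<le> \<epsilon> \<and> (differential_defect \<mu> \<rho> g f has_real_derivative d) (at_right x)"
    using bound[of t] t(1) by (intro exI conjI) auto
qed

lemma hilfer_integral_defect_bound:
  assumes h: "profile \<rho> h f" and "0 \<le> \<epsilon>"
    and bound: "\<And>t. t \<in> {a<..b} \<Longrightarrow> \<bar>hilfer \<mu> \<nu> \<Psi> \<Psi>' a b y t - h t\<bar> \<le> \<epsilon>"
    and x: "x \<in> {0..X b}"
  shows "\<bar>integral_defect \<mu> \<rho> g f x\<bar> \<le> \<epsilon> / Gamma (\<mu> + 1) * x powr (\<mu> + 1 - \<rho>)"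
  by (rule integral_defect_bound[OF \<mu>(1) orders_bounds(1,2) profile_continuous[OF y]
        profile_continuous[OF h] X_b_pos differential_defect_lipschitz[OF h \<open>0 \<le> \<epsilon>\<close> bound] x])

end

end


section \<open>Picard iteration and the Mittag-Leffler series\<close>

lemma powr_mult_exp_minus_le_Gamma:
  fixes A x :: real
  assumes "0 < A" "0 \<le> x"
  shows "A powr x * exp (- A) \<le> Gamma (x + 1)"
proof -
  have "((\<lambda>t. A powr x * exp (- 1 * t)) has_integral A powr x * (exp (- 1 * A) / 1)) {A..}"
    by (intro has_integral_mult_right has_integral_exp_minus_to_infinity) auto
  then have "((\<lambda>t. if t \<in> {A..} then A powr x * exp (- 1 * t) else 0) has_integral
      A powr x * (exp (- 1 * A) / 1)) {0..}"
    using assms by (subst has_integral_restrict) auto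
  moreover have "((\<lambda>t. t powr (x + 1 - 1) / exp t) has_integral Gamma (x + 1)) {0..}"
    using assms by (intro Gamma_integral_real) auto
  ultimately have "A powr x * (exp (- 1 * A) / 1) \<le> Gamma (x + 1)"
    by (rule has_integral_le)
      (use assms in \<open>auto simp: exp_minus field_simps intro!: powr_mono2\<close>)
  then show ?thesis
    by simp
qed

lemma summable_mittag_leffler:
  fixes \<mu> z :: real
  assumes "0 < \<mu>" "0 \<le> z"
  shows "summable (\<lambda>k. z ^ k / Gamma (real k * \<mu> + 1))"
proof (rule summable_comparison_test')
  define A where "A = (2 * z + 1) powr (1 / \<mu>)"
  have "0 < A"
    using assms by (simp add: A_def)
  show "summable (\<lambda>k. exp A * (1 / 2 :: real) ^ k)"
    by (intro summable_mult summable_geometric) simp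
  fix k :: nat
  have "A powr (real k * \<mu>) = (2 * z + 1) ^ k"
    using assms by (simp add: A_def powr_powr powr_realpow)
  then have Gamma_ge: "(2 * z + 1) ^ k * exp (- A) \<le> Gamma (real k * \<mu> + 1)"
    using powr_mult_exp_minus_le_Gamma[OF \<open>0 < A\<close>, of "real k * \<mu>"] assms by simp
  have pos: "0 < (2 * z + 1) ^ k * exp (- A)"
    using assms by simp
  have "z ^ k / Gamma (real k * \<mu> + 1) \<le> z ^ k / ((2 * z + 1) ^ k * exp (- A))"
    using Gamma_ge pos less_le_trans[OF pos Gamma_ge] assms
    by (intro divide_left_mono mult_pos_pos) auto
  also have "\<dots> = exp A * (z / (2 * z + 1)) ^ k"
    by (simp add: exp_minus power_divide field_simps)
  also have "\<dots> \<le> exp A * (1 / 2) ^ k"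
    using assms by (intro mult_left_mono power_mono) (auto simp: field_simps)
  finally show "norm (z ^ k / Gamma (real k * \<mu> + 1)) \<le> exp A * (1 / 2) ^ k"
    using less_le_trans[OF pos Gamma_ge] assms by simp
qed

lemma mittag_leffler_minus_1_sums:
  assumes "0 < \<mu>" "0 \<le> z"
  shows "(\<lambda>n. z ^ Suc n / Gamma (real (Suc n) * \<mu> + 1)) sums (mittag_leffler \<mu> z - 1)"
  using summable_sums[OF summable_mittag_leffler[OF assms]]
    sums_Suc_iff[of "\<lambda>k. z ^ k / Gamma (real k * \<mu> + 1)"]
  by (simp add: mittag_leffler_def)

lemma uniform_limit_of_summable_increments:
  fixes G :: "nat \<Rightarrow> 'a \<Rightarrow> 'b::banach"
  assumes bound: "\<And>n x. x \<in> S \<Longrightarrow> norm (G (Suc n) x - G n x) \<le> M n" and M: "M sums m"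
  obtains g where "uniform_limit S G g sequentially" "\<And>x. x \<in> S \<Longrightarrow> norm (G 0 x - g x) \<le> m"
proof -
  define D where "D x = (\<Sum>i. G (Suc i) x - G i x)" for x
  have "uniform_limit S (\<lambda>n x. G 0 x + (\<Sum>i<n. G (Suc i) x - G i x)) (\<lambda>x. G 0 x + D x) sequentially"
    unfolding D_def
    by (intro uniform_limit_add uniform_limit_const Weierstrass_m_test[OF bound sums_summable[OF M]])
  moreover have "G 0 x + (\<Sum>i<n. G (Suc i) x - G i x) = G n x" for n x
    using sum_lessThan_telescope[of "\<lambda>i. G i x" n] by simp
  ultimately have "uniform_limit S G (\<lambda>x. G 0 x + D x) sequentially"
    by simp
  moreover have "norm (G 0 x - (G 0 x + D x)) \<le> m" if "x \<in> S" for x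
    using norm_suminf_le[OF bound[OF that] sums_summable[OF M]] sums_unique[OF M] by (simp add: D_def)
  ultimately show thesis
    by (rule that)
qed

locale fractional_picard =
  fixes \<mu> \<rho> L B c :: real and N :: "(real \<Rightarrow> real) \<Rightarrow> real \<Rightarrow> real"
  assumes \<mu>_pos: "0 < \<mu>" and \<rho>_bounds: "0 < \<rho>" "\<rho> \<le> 1" and L_pos: "0 < L" and B_pos: "0 < B"
    and N_cont: "\<And>g. continuous_on {0..B} g \<Longrightarrow> continuous_on {0..B} (N g)"
    and N_lip: "\<And>g h s. continuous_on {0..B} g \<Longrightarrow> continuous_on {0..B} h \<Longrightarrow> s \<in> {0..B} \<Longrightarrow>
      \<bar>N g s - N h s\<bar> \<le> L * \<bar>g s - h s\<bar>"
begin

definition picard :: "(real \<Rightarrow> real) \<Rightarrow> real \<Rightarrow> real" where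
  "picard g x = c + x powr \<mu> * ek_int \<mu> \<rho> (N g) x"

lemma continuous_on_picard:
  "continuous_on {0..B} g \<Longrightarrow> continuous_on {0..B} (picard g)"
  unfolding picard_def[abs_def] using \<mu>_pos \<rho>_bounds
  by (intro continuous_on_add continuous_on_const continuous_on_powr_ek_int N_cont) auto

lemma continuous_on_picard_iterate:
  "continuous_on {0..B} g \<Longrightarrow> continuous_on {0..B} ((picard ^^ n) g)"
  by (induction n) (auto intro: continuous_on_picard)

lemma picard_diff_le:
  assumes g: "continuous_on {0..B} g" and h: "continuous_on {0..B} h" and x: "x \<in> {0..B}" and "0 \<le> q"
    and bound: "\<And>s. s \<in> {0..B} \<Longrightarrow> \<bar>g s - h s\<bar> \<le> C * s powr q"
  shows "\<bar>picard g x - picard h x\<bar> \<le> L * C * gamma_ratio \<mu> (\<rho> + q) * x powr (\<mu> + q)"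
proof (cases "x = 0")
  case False
  note integrable = ek_integrable_continuous[of \<mu> \<rho> B, OF less_imp_le[OF \<mu>_pos] \<rho>_bounds(1) _ x]
  have "\<bar>ek_int \<mu> \<rho> (\<lambda>s. N g s - N h s) x\<bar> \<le> L * C * x powr q * gamma_ratio \<mu> (\<rho> + q)"
  proof (rule ek_int_abs_le_powr)
    fix s assume "s \<in> {0<..x}"
    then have s: "s \<in> {0..B}"
      using x by auto
    have "\<bar>N g s - N h s\<bar> \<le> L * (C * s powr q)"
      using order_trans[OF N_lip[OF g h s] mult_left_mono[OF bound[OF s]]] L_pos by simp
    then show "\<bar>N g s - N h s\<bar> \<le> L * C * s powr q"
      by simp
  qed (use \<mu>_pos \<rho>_bounds \<open>0 \<le> q\<close> False x g h in \<open>auto intro!: integrable continuous_on_diff N_cont\<close>)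
  moreover have "picard g x - picard h x = x powr \<mu> * ek_int \<mu> \<rho> (\<lambda>s. N g s - N h s) x"
    by (simp add: picard_def ek_int_diff integrable N_cont g h right_diff_distrib)
  ultimately have "\<bar>picard g x - picard h x\<bar> \<le> x powr \<mu> * (L * C * x powr q * gamma_ratio \<mu> (\<rho> + q))"
    by (simp add: abs_mult mult_left_mono)
  then show ?thesis
    by (simp add: powr_add mult_ac)
qed (simp add: picard_def)

lemma picard_tendsto:
  assumes G: "\<And>n. continuous_on {0..B} (G n)" and g: "continuous_on {0..B} g"
    and lim: "uniform_limit {0..B} G g F" and x: "x \<in> {0..B}"
  shows "((\<lambda>n. picard (G n) x) \<longlongrightarrow> picard g x) F"
proof -
  have "uniform_limit {0..B} (\<lambda>n. N (G n)) (N g) F"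
  proof (rule uniform_limitI)
    fix e :: real assume "0 < e"
    then have "\<forall>\<^sub>F n in F. \<forall>s\<in>{0..B}. dist (G n s) (g s) < e / L"
      using L_pos by (intro uniform_limitD[OF lim]) auto
    then show "\<forall>\<^sub>F n in F. \<forall>s\<in>{0..B}. dist (N (G n) s) (N g s) < e"
    proof (eventually_elim, intro ballI)
      fix n s assume "\<forall>s\<in>{0..B}. dist (G n s) (g s) < e / L" and s: "s \<in> {0..B}"
      then have "L * \<bar>G n s - g s\<bar> < e"
        using L_pos by (simp add: dist_real_def field_simps)
      then show "dist (N (G n) s) (N g s) < e"
        using N_lip[OF G g s, of n] by (simp add: dist_real_def)
    qed
  qed
  then have "uniform_limit {0..B} (\<lambda>n. ek_int \<mu> \<rho> (N (G n))) (ek_int \<mu> \<rho> (N g)) F"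
    using \<mu>_pos \<rho>_bounds by (intro ek_int_uniform_limit N_cont G g) auto
  from tendsto_uniform_limitI[OF this x] show ?thesis
    unfolding picard_def by (intro tendsto_intros)
qed

context
  fixes g\<^sub>0 :: "real \<Rightarrow> real" and \<epsilon> :: real
  assumes g\<^sub>0: "continuous_on {0..B} g\<^sub>0" and \<epsilon>: "0 \<le> \<epsilon>"
    and defect: "\<And>x. x \<in> {0..B} \<Longrightarrow>
      \<bar>g\<^sub>0 x - picard g\<^sub>0 x\<bar> \<le> \<epsilon> / Gamma (\<mu> + 1) * x powr (\<mu> + 1 - \<rho>)"
begin

lemma picard_increment_le:
  assumes "x \<in> {0..B}"
  shows "\<bar>(picard ^^ Suc n) g\<^sub>0 x - (picard ^^ n) g\<^sub>0 x\<bar>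
    \<le> \<epsilon> * L ^ n / Gamma (real (Suc n) * \<mu> + 1) * x powr (real (Suc n) * \<mu> + 1 - \<rho>)"
  using assms
proof (induction n arbitrary: x)
  case 0
  then show ?case
    using defect[of x] by (simp add: abs_minus_commute)
next
  case (Suc n)
  define q where "q = real (Suc n) * \<mu> + 1 - \<rho>"
  have "0 \<le> real (Suc n) * \<mu>"
    using \<mu>_pos by simp
  then have "0 \<le> q" and Gamma_pos: "0 < Gamma (real (Suc n) * \<mu> + 1)"
    using \<rho>_bounds by (auto simp: q_def intro!: Gamma_real_pos)
  have "\<bar>(picard ^^ Suc (Suc n)) g\<^sub>0 x - (picard ^^ Suc n) g\<^sub>0 x\<bar>
      = \<bar>picard ((picard ^^ Suc n) g\<^sub>0) x - picard ((picard ^^ n) g\<^sub>0) x\<bar>"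
    by simp
  also have "\<dots> \<le> L * (\<epsilon> * L ^ n / Gamma (real (Suc n) * \<mu> + 1)) * gamma_ratio \<mu> (\<rho> + q) * x powr (\<mu> + q)"
    using Suc \<open>0 \<le> q\<close> by (intro picard_diff_le continuous_on_picard_iterate g\<^sub>0) (auto simp: q_def)
  also have "\<dots> = \<epsilon> * L ^ Suc n / Gamma (real (Suc (Suc n)) * \<mu> + 1) * x powr (real (Suc (Suc n)) * \<mu> + 1 - \<rho>)"
    using Gamma_pos by (simp add: gamma_ratio_def q_def algebra_simps)
  finally show ?case .
qed

lemma picard_increment_le_mittag_leffler_term:
  assumes "x \<in> {0..B}"
  shows "\<bar>(picard ^^ Suc n) g\<^sub>0 x - (picard ^^ n) g\<^sub>0 x\<bar>
    \<le> \<epsilon> * B powr (1 - \<rho>) / L * ((L * B powr \<mu>) ^ Suc n / Gamma (real (Suc n) * \<mu> + 1))"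
proof -
  have "0 \<le> real (Suc n) * \<mu>"
    using \<mu>_pos by simp
  then have "0 \<le> real (Suc n) * \<mu> + 1 - \<rho>" and "0 < Gamma (real (Suc n) * \<mu> + 1)"
    using \<rho>_bounds by (auto intro!: Gamma_real_pos)
  then have "\<epsilon> * L ^ n / Gamma (real (Suc n) * \<mu> + 1) * x powr (real (Suc n) * \<mu> + 1 - \<rho>)
      \<le> \<epsilon> * L ^ n / Gamma (real (Suc n) * \<mu> + 1) * B powr (real (Suc n) * \<mu> + 1 - \<rho>)"
    using assms \<epsilon> L_pos by (intro mult_left_mono powr_mono2) auto
  also have "B powr (real (Suc n) * \<mu> + 1 - \<rho>) = (B powr \<mu>) powr real (Suc n) * B powr (1 - \<rho>)"
    unfolding powr_powr powr_add[symmetric] by (simp add: algebra_simps)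
  also have "(B powr \<mu>) powr real (Suc n) = (B powr \<mu>) ^ Suc n"
    using B_pos by (intro powr_realpow) auto
  also have "\<epsilon> * L ^ n / Gamma (real (Suc n) * \<mu> + 1) * ((B powr \<mu>) ^ Suc n * B powr (1 - \<rho>))
      = \<epsilon> * B powr (1 - \<rho>) / L * ((L * B powr \<mu>) ^ Suc n / Gamma (real (Suc n) * \<mu> + 1))"
    unfolding power_mult_distrib using L_pos by simp
  finally show ?thesis
    using picard_increment_le[OF assms, of n] by linarith
qed

lemma picard_fixed_point:
  obtains g where "continuous_on {0..B} g" "\<And>x. x \<in> {0..B} \<Longrightarrow> g x = picard g x"
    and "\<And>x. x \<in> {0..B} \<Longrightarrow> \<bar>g\<^sub>0 x - g x\<bar> \<le> (mittag_leffler \<mu> (L * B powr \<mu>) - 1) / L * B powr (1 - \<rho>) * \<epsilon>"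
proof -
  define G where "G n = (picard ^^ n) g\<^sub>0" for n
  have G: "continuous_on {0..B} (G n)" and G_Suc: "G (Suc n) = picard (G n)" for n
    unfolding G_def using continuous_on_picard_iterate[OF g\<^sub>0] by auto
  have majorant: "(\<lambda>n. \<epsilon> * B powr (1 - \<rho>) / L * ((L * B powr \<mu>) ^ Suc n / Gamma (real (Suc n) * \<mu> + 1)))
      sums (\<epsilon> * B powr (1 - \<rho>) / L * (mittag_leffler \<mu> (L * B powr \<mu>) - 1))"
    using \<mu>_pos L_pos by (intro sums_mult mittag_leffler_minus_1_sums) auto
  have increments: "norm (G (Suc n) x - G n x)
      \<le> \<epsilon> * B powr (1 - \<rho>) / L * ((L * B powr \<mu>) ^ Suc n / Gamma (real (Suc n) * \<mu> + 1))"
    if "x \<in> {0..B}" for n x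
    using picard_increment_le_mittag_leffler_term[OF that, of n] by (simp only: G_def real_norm_def)
  obtain g where lim: "uniform_limit {0..B} G g sequentially"
    and bound: "\<And>x. x \<in> {0..B} \<Longrightarrow>
      norm (G 0 x - g x) \<le> \<epsilon> * B powr (1 - \<rho>) / L * (mittag_leffler \<mu> (L * B powr \<mu>) - 1)"
    using uniform_limit_of_summable_increments[where S = "{0..B}" and G = G, OF increments majorant]
    by blast
  have g: "continuous_on {0..B} g"
    by (rule uniform_limit_theorem[OF _ lim]) (use G in auto)
  have "g x = picard g x" if "x \<in> {0..B}" for x
    using picard_tendsto[OF G g lim that] LIMSEQ_Suc[OF tendsto_uniform_limitI[OF lim that]]
    unfolding G_Suc by (intro LIMSEQ_unique)
  then show thesis
    using that[OF g] bound by (simp add: G_def mult_ac)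
qed

end

end

section \<open>Ulam-Hyers stability\<close>

context psi_scale
begin

lemma profile_superposition_lipschitz:
  assumes y: "profile \<rho> y g" "profile \<rho> (\<lambda>t. f t (y t)) u"
    and z: "profile \<rho> z h" "profile \<rho> (\<lambda>t. f t (z t)) v"
    and lip: "\<And>t p q. t \<in> {a<..b} \<Longrightarrow> \<bar>f t p - f t q\<bar> \<le> L * \<bar>p - q\<bar>" and s: "s \<in> {0..X b}"
  shows "\<bar>u s - v s\<bar> \<le> L * \<bar>g s - h s\<bar>"
proof -
  define d where "d s = L * \<bar>g s - h s\<bar> - \<bar>u s - v s\<bar>" for s
  have interior: "0 \<le> d x" if x: "x \<in> {0<..X b}" for x
  proof -
    obtain t where t: "t \<in> {a<..b}" "x = X t"
      using Ioc_X_cases[OF x] .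
    have "X t powr (1 - \<rho>) * \<bar>f t (y t) - f t (z t)\<bar> \<le> X t powr (1 - \<rho>) * (L * \<bar>y t - z t\<bar>)"
      using lip[OF t(1)] by (intro mult_left_mono) auto
    moreover have "X t powr (1 - \<rho>) * (L * \<bar>y t - z t\<bar>)
        = L * \<bar>X t powr (1 - \<rho>) * y t - X t powr (1 - \<rho>) * z t\<bar>"
      by (simp add: abs_mult flip: right_diff_distrib)
    moreover have "X t powr (1 - \<rho>) * \<bar>f t (y t) - f t (z t)\<bar>
        = \<bar>X t powr (1 - \<rho>) * f t (y t) - X t powr (1 - \<rho>) * f t (z t)\<bar>"
      by (simp add: abs_mult flip: right_diff_distrib)
    ultimately show ?thesis
      using profile_weighted_eq[OF y(1) t(1)] profile_weighted_eq[OF y(2) t(1)]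
        profile_weighted_eq[OF z(1) t(1)] profile_weighted_eq[OF z(2) t(1)] t(2)
      by (simp add: d_def)
  qed
  have "continuous_on {0..X b} d"
    unfolding d_def[abs_def] using y z by (intro continuous_intros profile_continuous)
  then have "continuous_on (closure {0<..X b}) d" "s \<in> closure {0<..X b}"
    using X_b_pos s by auto
  then have "0 \<le> d s"
    by (rule continuous_ge_on_closure) (rule interior)
  then show ?thesis
    by (simp add: d_def)
qed

lemma superposition_operator:
  assumes wC: "\<And>y. wC \<Psi> a b \<rho> y \<Longrightarrow> wC \<Psi> a b \<rho> (\<lambda>t. f t (y t))"
    and lip: "\<And>t p q. t \<in> {a<..b} \<Longrightarrow> \<bar>f t p - f t q\<bar> \<le> L * \<bar>p - q\<bar>"
  obtains N where "\<And>y g. profile \<rho> y g \<Longrightarrow> profile \<rho> (\<lambda>t. f t (y t)) (N g)"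
    and "\<And>g. continuous_on {0..X b} g \<Longrightarrow> continuous_on {0..X b} (N g)"
    and "\<And>g h s. continuous_on {0..X b} g \<Longrightarrow> continuous_on {0..X b} h \<Longrightarrow> s \<in> {0..X b} \<Longrightarrow>
      \<bar>N g s - N h s\<bar> \<le> L * \<bar>g s - h s\<bar>"
proof -
  define w where "w g t = X t powr (\<rho> - 1) * g (X t)" for g t
  have w: "profile \<rho> (w g) g" if "continuous_on {0..X b} g" for g
    using that by (simp add: profile_def w_def)
  have "\<exists>h. profile \<rho> (\<lambda>t. f t (w g t)) h" if "continuous_on {0..X b} g" for g
    using wC[of "w g"] w[OF that] unfolding wC_iff_profile by blast
  then obtain N where N: "\<And>g. continuous_on {0..X b} g \<Longrightarrow> profile \<rho> (\<lambda>t. f t (w g t)) (N g)"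
    by metis
  have "profile \<rho> (\<lambda>t. f t (y t)) (N g)" if "profile \<rho> y g" for y g
    using N[OF profile_continuous[OF that]] profile_eq[OF that] by (simp add: profile_def w_def)
  moreover have "continuous_on {0..X b} (N g)" if "continuous_on {0..X b} g" for g
    using profile_continuous[OF N[OF that]] .
  moreover have "\<bar>N g s - N h s\<bar> \<le> L * \<bar>g s - h s\<bar>"
    if "continuous_on {0..X b} g" "continuous_on {0..X b} h" "s \<in> {0..X b}" for g h s
    using profile_superposition_lipschitz[OF w N w N lip that(3), OF that(1,1,2,2)] .
  ultimately show thesis
    by (rule that)
qed

lemma profile_integral_equation:
  assumes y: "profile \<rho> y g" and h: "profile \<rho> h f" and "0 < \<rho>" "0 < \<mu>"
    and g: "\<And>x. x \<in> {0..X b} \<Longrightarrow> g x = c + x powr \<mu> * ek_int \<mu> \<rho> f x" and t: "t \<in> {a<..b}"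
  shows "y t = (\<Psi> t - \<Psi> a) powr (\<rho> - 1) / Gamma \<rho> * (Gamma \<rho> * c) + frac_int \<mu> \<Psi> \<Psi>' a h t"
proof -
  have "frac_int \<mu> \<Psi> \<Psi>' a h t = X t powr (\<rho> - 1) * (X t powr \<mu> * ek_int \<mu> \<rho> f (X t))"
    using frac_int_profile[OF h _ _ t, of \<mu>] assms(3,4) by (simp add: algebra_simps flip: powr_add)
  moreover have "y t = X t powr (\<rho> - 1) * (c + X t powr \<mu> * ek_int \<mu> \<rho> f (X t))"
    using profile_eq[OF y t] g[of "X t"] X_mem[OF t] by simp
  moreover have "(\<Psi> t - \<Psi> a) powr (\<rho> - 1) / Gamma \<rho> * (Gamma \<rho> * c) = X t powr (\<rho> - 1) * c"
    using less_imp_neq[OF Gamma_real_pos[OF \<open>0 < \<rho>\<close>]] by (simp add: X_def)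
  ultimately show ?thesis
    by (simp add: distrib_left)
qed

end

lemma psi_scale_of_mono_on:
  assumes "a < b" and deriv: "\<And>t. t \<in> {a..b} \<Longrightarrow> (\<Psi> has_real_derivative \<Psi>' t) (at t within {a..b})"
    and "continuous_on {a..b} \<Psi>'" "mono_on {a..b} \<Psi>" and "\<And>t. t \<in> {a..b} \<Longrightarrow> \<Psi>' t \<noteq> 0"
  shows "psi_scale a b \<Psi> \<Psi>'"
proof
  show "0 < \<Psi>' t" if "t \<in> {a..b}" for t
    using mono_on_Icc_imp_deriv_nonneg[OF assms(1,4) deriv assms(3) that] assms(5)[OF that] by simp
qed (use assms in auto)

lemma (in hilfer_setting) solution_near_approximate_solution:
  assumes wC: "\<And>y. wC \<Psi> a b \<rho> y \<Longrightarrow> wC \<Psi> a b \<rho> (\<lambda>t. f t (y t))"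
    and lip: "\<And>t p q. t \<in> {a<..b} \<Longrightarrow> \<bar>f t p - f t q\<bar> \<le> L * \<bar>p - q\<bar>" and "0 < L" "0 \<le> \<epsilon>"
    and z: "profile \<rho> z h" "hilfer_exists \<mu> \<nu> \<Psi> \<Psi>' a b z"
    and approx: "\<And>t. t \<in> {a<..b} \<Longrightarrow> \<bar>hilfer \<mu> \<nu> \<Psi> \<Psi>' a b z t - f t (z t)\<bar> \<le> \<epsilon>"
  obtains y g u where "profile \<rho> y g" "profile \<rho> (\<lambda>t. f t (y t)) u"
    and "\<And>x. x \<in> {0..X b} \<Longrightarrow> g x = h 0 + x powr \<mu> * ek_int \<mu> \<rho> u x"
    and "\<And>x. x \<in> {0..X b} \<Longrightarrow>
      \<bar>h x - g x\<bar> \<le> (mittag_leffler \<mu> (L * X b powr \<mu>) - 1) / L * X b powr (1 - \<rho>) * \<epsilon>"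
proof -
  obtain N where N: "\<And>y g. profile \<rho> y g \<Longrightarrow> profile \<rho> (\<lambda>t. f t (y t)) (N g)"
    and N_cont: "\<And>g. continuous_on {0..X b} g \<Longrightarrow> continuous_on {0..X b} (N g)"
    and N_lip: "\<And>g h s. continuous_on {0..X b} g \<Longrightarrow> continuous_on {0..X b} h \<Longrightarrow> s \<in> {0..X b} \<Longrightarrow>
      \<bar>N g s - N h s\<bar> \<le> L * \<bar>g s - h s\<bar>"
    using superposition_operator[of \<rho> f L, OF wC lip] by blast
  interpret fractional_picard \<mu> \<rho> L "X b" "h 0" N
    by unfold_locales (use \<mu> orders_bounds \<open>0 < L\<close> X_b_pos N_cont N_lip in auto)
  have defect: "\<bar>h x - picard h x\<bar> \<le> \<epsilon> / Gamma (\<mu> + 1) * x powr (\<mu> + 1 - \<rho>)" if "x \<in> {0..X b}" for x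
    using hilfer_integral_defect_bound[OF z N[OF z(1)] \<open>0 \<le> \<epsilon>\<close> approx that]
    by (simp add: integral_defect_def picard_def)
  obtain g where g: "continuous_on {0..X b} g" "\<And>x. x \<in> {0..X b} \<Longrightarrow> g x = picard g x"
    and bound: "\<And>x. x \<in> {0..X b} \<Longrightarrow>
      \<bar>h x - g x\<bar> \<le> (mittag_leffler \<mu> (L * X b powr \<mu>) - 1) / L * X b powr (1 - \<rho>) * \<epsilon>"
    using picard_fixed_point[OF profile_continuous[OF z(1)] \<open>0 \<le> \<epsilon>\<close> defect] by blast
  have y: "profile \<rho> (\<lambda>t. X t powr (\<rho> - 1) * g (X t)) g"
    using g(1) by (simp add: profile_def)
  show thesis
    by (rule that[OF y N[OF y] _ bound]) (use g(2) in \<open>auto simp: picard_def\<close>)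
qed

theorem theorem4p1:
  fixes a b \<mu> \<nu> \<rho> L \<epsilon> :: real
    and \<Psi> \<Psi>' :: "real \<Rightarrow> real"
    and f :: "real \<Rightarrow> real \<Rightarrow> real"
    and ystar :: "real \<Rightarrow> real"
  assumes "0 < a" and "a < b"
    and "\<forall>t\<in>{a..b}. (\<Psi> has_real_derivative \<Psi>' t) (at t within {a..b})"
    and "continuous_on {a..b} \<Psi>'"
    and "mono_on {a..b} \<Psi>"
    and "\<forall>t\<in>{a..b}. \<Psi>' t \<noteq> 0"
    and "0 < \<mu>" and "\<mu> < 1" and "0 \<le> \<nu>" and "\<nu> \<le> 1"
    and "\<rho> = \<mu> + \<nu> - \<mu> * \<nu>"
    and "\<forall>y. wC \<Psi> a b \<rho> y \<longrightarrow> wC \<Psi> a b \<rho> (\<lambda>t. f t (y t))"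
    and "0 < L"
    and "\<forall>t\<in>{a<..b}. \<forall>y1 y2. \<bar>f t y1 - f t y2\<bar> \<le> L * \<bar>y1 - y2\<bar>"
    and "0 < \<epsilon>"
    and "wC \<Psi> a b \<rho> ystar"
    and "hilfer_exists \<mu> \<nu> \<Psi> \<Psi>' a b ystar"
    and "\<forall>t\<in>{a<..b}. \<bar>hilfer \<mu> \<nu> \<Psi> \<Psi>' a b ystar t - f t (ystar t)\<bar> \<le> \<epsilon>"
  shows "\<exists>y c. ((frac_int (1 - \<rho>) \<Psi> \<Psi>' a ystar) \<longlongrightarrow> c) (at_right a)
           \<and> wC \<Psi> a b \<rho> y
           \<and> (\<forall>t\<in>{a<..b}. y t = (\<Psi> t - \<Psi> a) powr (\<rho> - 1) / Gamma \<rho> * c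
                                + frac_int \<mu> \<Psi> \<Psi>' a (\<lambda>s. f s (y s)) t)
           \<and> wC_norm \<Psi> a b \<rho> (\<lambda>t. ystar t - y t)
               \<le> ((mittag_leffler \<mu> (L * (\<Psi> b - \<Psi> a) powr \<mu>) - 1) / L
                   * (\<Psi> b - \<Psi> a) powr (1 - \<rho>)) * \<epsilon>"
proof -
  interpret psi_scale a b \<Psi> \<Psi>'
    using assms by (intro psi_scale_of_mono_on) auto
  interpret hilfer_setting a b \<Psi> \<Psi>' \<mu> \<nu> \<rho>
    by unfold_locales (use assms in auto)
  obtain h where h: "profile \<rho> ystar h"
    using \<open>wC \<Psi> a b \<rho> ystar\<close> unfolding wC_iff_profile by blast
  obtain y g u where y: "profile \<rho> y g" "profile \<rho> (\<lambda>t. f t (y t)) u"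
    and fixed_point: "\<And>x. x \<in> {0..X b} \<Longrightarrow> g x = h 0 + x powr \<mu> * ek_int \<mu> \<rho> u x"
    and bound: "\<And>x. x \<in> {0..X b} \<Longrightarrow>
      \<bar>h x - g x\<bar> \<le> (mittag_leffler \<mu> (L * X b powr \<mu>) - 1) / L * X b powr (1 - \<rho>) * \<epsilon>"
    using solution_near_approximate_solution[of f L \<epsilon>, OF _ _ _ _ h] assms(12-18) by auto
  have "(frac_int (1 - \<rho>) \<Psi> \<Psi>' a ystar \<longlongrightarrow> Gamma \<rho> * h 0) (at_right a)"
    by (rule frac_int_tendsto_at_right[OF h orders_bounds(3,2)])
  moreover have "wC \<Psi> a b \<rho> y"
    using y(1) wC_iff_profile by blast
  moreover note profile_integral_equation[OF y orders_bounds(3) \<mu>(1) fixed_point]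
    wC_norm_profile_diff_le[OF h y(1) bound, unfolded X_def]
  ultimately show ?thesis
    by blast
qed

end
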